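(* Let $F$ be a field of characteristic zero, $k\ge2$, and $L=\operatorname{Der}(M_k(F))$ the Lie algebra of all derivations of $M_k(F)$, acting on $M_k(F)$. Then: (1) $\exp^L(M_k(F))=k^2$. (2) The generating function of the differential codimensions, $C_k^L(x):=\sum_{n=0}^\infty c_n^L(M_k(F))x^n$ (with $c_0^L(M_k(F)):=1$), is rational: $$C_k^L(x)=\frac{k^2}{1-k^2x}-\frac{k^2-1}{(1-x)^2}.$$
   Context: $U(L)$ is the universal enveloping algebra of $L$; the action of $L$ on $B:=M_k(F)$ by derivations extends to a unital algebra homomorphism $\phi:U(L)\to\operatorname{End}_F(B)$, and $b^u:=\phi(u)(b)$. The free $L$-algebra $F\langle X|L\rangle$ on $X=\{x_1,x_2,\dots\}$ is the nonunital associative algebra generated by symbols $x_i^u$ ($u\in U(L)$), linear in $u$, with $x_i^1=x_i$; it is free on $\{x_i^e\}$ for $e$ in a basis of $U(L)$. $\operatorname{Id}^L(B)$ is the set of $f\in F\langle X|L\rangle$ vanishing under every substitution $x_i\mapsto b_i\in B$ (with $x_i^u\mapsto b_i^u$). For $n\ge1$, $P_n^L$ is the span of the multilinear elements $x_{\sigma(1)}^{u_1}\cdots x_{\sigma(n)}^{u_n}$, $\sigma\in S_n$, $u_i\in U(L)$; $c_n^L(B):=\dim_F P_n^L/(P_n^L\cap\operatorname{Id}^L(B))$, and $\exp^L(B):=\lim_{n\to\infty}\sqrt[n]{c_n^L(B)}$. *)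

theory Defs
  imports
    "HOL-Analysis.Finite_Cartesian_Product"
    "HOL-Analysis.Cartesian_Space"
    "HOL-Library.Poly_Mapping"
    "HOL-Combinatorics.Permutations"
    "HOL-Computational_Algebra.Formal_Power_Series"
    "Jordan_Normal_Form.Missing_VectorSpace"
begin

hide_const (open) VectorSpace.subspace
hide_fact (open) VectorSpace.subspace_def

subsection \<open>Quotients of vector spaces\<close>

definition field_ring :: "'f::field ring" where
  "field_ring = \<lparr>carrier = UNIV, mult = (*), one = 1, zero = 0, add = (+)\<rparr>"

text \<open>The quotient \<^term>\<open>V/W\<close> of two subspaces \<open>W \<subseteq> V\<close> of a vector space with scalar
  multiplication \<open>s\<close>; its elements are the cosets \<open>v + W\<close>. The fields \<open>mult\<close> and \<open>one\<close>, which
  the record type for modules inherits from rings, play no role.\<close>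

definition coset :: "'v::ab_group_add set \<Rightarrow> 'v \<Rightarrow> 'v set" where
  "coset W v = {v + w | w. w \<in> W}"

definition quotient_space ::
    "('f::field \<Rightarrow> 'v::ab_group_add \<Rightarrow> 'v) \<Rightarrow> 'v set \<Rightarrow> 'v set \<Rightarrow> ('f, 'v set) module" where
  "quotient_space s V W =
     \<lparr>carrier = coset W ` V, mult = undefined, one = undefined, zero = W,
      add = (\<lambda>A B. {a + b | a b. a \<in> A \<and> b \<in> B}),
      smult = (\<lambda>c A. {s c a + w | a w. a \<in> A \<and> w \<in> W})\<rparr>"

context vector_space
begin

lemma coset_eq_iff:
  assumes "subspace W"
  shows "coset W u = coset W v \<longleftrightarrow> u - v \<in> W"
proof
  assume "coset W u = coset W v"
  moreover have "u \<in> coset W u"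
    using subspace_0[OF assms] by (force simp: coset_def)
  ultimately obtain w where "w \<in> W" "u = v + w" by (auto simp: coset_def)
  then show "u - v \<in> W" by simp
next
  assume d: "u - v \<in> W"
  have "u + w = v + (u - v + w) \<and> v + w = u + (w - (u - v))" for w by (simp add: algebra_simps)
  moreover have "u - v + w \<in> W" "w - (u - v) \<in> W" if "w \<in> W" for w
    using d that assms by (auto intro: subspace_add subspace_diff)
  ultimately show "coset W u = coset W v" unfolding coset_def by blast
qed

lemma coset_add:
  assumes "subspace W"
  shows "{a + b | a b. a \<in> coset W u \<and> b \<in> coset W v} = coset W (u + v)"
proof -
  have "u + w + (v + w') = u + v + (w + w')" for w w' by (simp add: algebra_simps)
  moreover have "u + v + w = u + w + (v + 0)" for w by (simp add: algebra_simps)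
  ultimately show ?thesis
    using subspace_add[OF assms] subspace_0[OF assms] unfolding coset_def by fast
qed

lemma coset_scale:
  assumes "subspace W"
  shows "{scale c a + w | a w. a \<in> coset W u \<and> w \<in> W} = coset W (scale c u)"
proof -
  have "scale c (u + w) + w' = scale c u + (scale c w + w')" for w w'
    by (simp add: scale_right_distrib algebra_simps)
  moreover have "scale c u + w = scale c (u + 0) + w" for w by simp
  ultimately show ?thesis
    using subspace_add[OF assms] subspace_0[OF assms] subspace_scale[OF assms]
    unfolding coset_def by fast
qed

lemma coset_zero: "coset W 0 = W"
  by (simp add: coset_def)

lemma vectorspace_quotient_space:
  assumes V: "subspace V" and W: "subspace W" and "W \<subseteq> V"
  shows "vectorspace field_ring (quotient_space scale V W)"
proof -
  let ?K = "field_ring :: 'a ring" and ?Q = "quotient_space scale V W"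
  note defs = quotient_space_def field_ring_def
  have K: "Ring.field ?K"
  proof (rule cring.cring_fieldI2)
    show "cring ?K"
    proof (rule cringI)
      show "abelian_group ?K"
        by (rule abelian_groupI) (auto simp: field_ring_def algebra_simps intro: exI[of _ "- x" for x])
      show "Group.comm_monoid ?K"
        by (rule comm_monoidI) (auto simp: field_ring_def algebra_simps)
    qed (auto simp: field_ring_def algebra_simps)
    show "\<zero>\<^bsub>?K\<^esub> \<noteq> \<one>\<^bsub>?K\<^esub>" by (simp add: field_ring_def)
    show "\<exists>b\<in>carrier ?K. a \<otimes>\<^bsub>?K\<^esub> b = \<one>\<^bsub>?K\<^esub>" if "a \<in> carrier ?K" "a \<noteq> \<zero>\<^bsub>?K\<^esub>" for a
      using that by (auto simp: field_ring_def intro: exI[of _ "inverse a"])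
  qed
  have A: "abelian_group ?Q"
  proof (rule abelian_groupI)
    show "\<zero>\<^bsub>?Q\<^esub> \<in> carrier ?Q"
      using coset_zero[of W] subspace_0[OF V] by (auto simp: defs image_iff)
    fix A assume "A \<in> carrier ?Q"
    then obtain u where u: "u \<in> V" "A = coset W u" by (auto simp: defs)
    show "\<zero>\<^bsub>?Q\<^esub> \<oplus>\<^bsub>?Q\<^esub> A = A"
      using coset_add[OF W, of 0 u] by (simp add: defs u coset_zero)
    show "\<exists>B\<in>carrier ?Q. B \<oplus>\<^bsub>?Q\<^esub> A = \<zero>\<^bsub>?Q\<^esub>"
      using u coset_add[OF W, of "- u" u] subspace_neg[OF V]
      by (intro bexI[of _ "coset W (- u)"]) (auto simp: defs coset_zero)
    fix B assume "B \<in> carrier ?Q"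
    then obtain v where v: "v \<in> V" "B = coset W v" by (auto simp: defs)
    show "A \<oplus>\<^bsub>?Q\<^esub> B \<in> carrier ?Q"
      using u v subspace_add[OF V] by (auto simp: defs coset_add[OF W])
    show "A \<oplus>\<^bsub>?Q\<^esub> B = B \<oplus>\<^bsub>?Q\<^esub> A"
      by (simp add: defs coset_add[OF W] u v add.commute)
    fix C assume "C \<in> carrier ?Q"
    then obtain x where x: "x \<in> V" "C = coset W x" by (auto simp: defs)
    show "A \<oplus>\<^bsub>?Q\<^esub> B \<oplus>\<^bsub>?Q\<^esub> C = A \<oplus>\<^bsub>?Q\<^esub> (B \<oplus>\<^bsub>?Q\<^esub> C)"
      by (simp add: defs coset_add[OF W] u v x add.assoc)
  qed
  have scl: "c \<odot>\<^bsub>?Q\<^esub> coset W u = coset W (scale c u)" for c u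
    by (simp add: quotient_space_def coset_scale[OF W])
  have plus: "coset W u \<oplus>\<^bsub>?Q\<^esub> coset W v = coset W (u + v)" for u v
    by (simp add: quotient_space_def coset_add[OF W])
  have "Module.module ?K ?Q"
  proof (rule moduleI[OF field.axioms(1)[OF K, THEN domain.axioms(1)] A])
    fix a A assume "A \<in> carrier ?Q"
    then obtain u where u: "u \<in> V" "A = coset W u" by (auto simp: defs)
    show "a \<odot>\<^bsub>?Q\<^esub> A \<in> carrier ?Q"
      using u(1) subspace_scale[OF V, of u a] unfolding u(2) scl by (simp add: quotient_space_def)
    show "\<one>\<^bsub>?K\<^esub> \<odot>\<^bsub>?Q\<^esub> A = A"
      unfolding u(2) scl by (simp add: field_ring_def)
    fix b
    show "(a \<oplus>\<^bsub>?K\<^esub> b) \<odot>\<^bsub>?Q\<^esub> A = a \<odot>\<^bsub>?Q\<^esub> A \<oplus>\<^bsub>?Q\<^esub> b \<odot>\<^bsub>?Q\<^esub> A"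
      unfolding u(2) scl plus by (simp add: field_ring_def scale_left_distrib)
    show "(a \<otimes>\<^bsub>?K\<^esub> b) \<odot>\<^bsub>?Q\<^esub> A = a \<odot>\<^bsub>?Q\<^esub> (b \<odot>\<^bsub>?Q\<^esub> A)"
      unfolding u(2) scl by (simp add: field_ring_def)
    fix B assume "B \<in> carrier ?Q"
    then obtain v where v: "v \<in> V" "B = coset W v" by (auto simp: defs)
    show "a \<odot>\<^bsub>?Q\<^esub> (A \<oplus>\<^bsub>?Q\<^esub> B) = a \<odot>\<^bsub>?Q\<^esub> A \<oplus>\<^bsub>?Q\<^esub> a \<odot>\<^bsub>?Q\<^esub> B"
      unfolding u(2) v(2) scl plus by (simp add: scale_right_distrib)
  qed
  with K show ?thesis by (simp add: vectorspace_def)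
qed

end

subsection \<open>Free algebras\<close>

text \<open>With concatenation as addition on lists, \<^typ>\<open>'a list \<Rightarrow>\<^sub>0 'f\<close> is the
  free unital associative algebra on \<^typ>\<open>'a\<close> over \<^typ>\<open>'f\<close>: the library multiplication of
  finitely supported functions is convolution of words.\<close>

instantiation list :: (type) monoid_add
begin

definition "0 = []"
definition "xs + ys = xs @ ys"

instance by standard (auto simp: zero_list_def plus_list_def)

end

abbreviation word :: "'a list \<Rightarrow> 'f \<Rightarrow> 'a list \<Rightarrow>\<^sub>0 'f::zero" where
  "word \<equiv> Poly_Mapping.single"

definition pm_scale :: "'f::field \<Rightarrow> ('a \<Rightarrow>\<^sub>0 'f) \<Rightarrow> ('a \<Rightarrow>\<^sub>0 'f)" where
  "pm_scale c = Poly_Mapping.map ((*) c)"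

lemma lookup_pm_scale [simp]:
  "Poly_Mapping.lookup (pm_scale c p) a = c * Poly_Mapping.lookup p a"
  by (simp add: pm_scale_def Poly_Mapping.map.rep_eq when_def)

lemma vector_space_pm_scale: "vector_space pm_scale"
  by standard (auto intro!: poly_mapping_eqI simp: lookup_add algebra_simps)

lemma pm_scale_word [simp]: "pm_scale c (word w a) = word w (c * a)"
  by (rule poly_mapping_eqI) (simp add: lookup_single when_def)

lemma word_mult: "word v a * word w b = word (v @ w) (a * b :: 'f::field)"
  by (simp add: mult_single plus_list_def)

lemma pm_scale_eq_mult:
  "pm_scale c (p :: 'a list \<Rightarrow>\<^sub>0 'f::field) = word [] c * p"
  "pm_scale c (p :: 'a list \<Rightarrow>\<^sub>0 'f::field) = p * word [] c"
proof -
  interpret vector_space "pm_scale :: 'f \<Rightarrow> ('a list \<Rightarrow>\<^sub>0 'f) \<Rightarrow> _" by (rule vector_space_pm_scale)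
  have p: "p = (\<Sum>w\<in>Poly_Mapping.keys p. word w (Poly_Mapping.lookup p w))"
    by (rule poly_mapping_eqI)
       (auto simp: lookup_sum lookup_single when_def sum.delta in_keys_iff)
  show "pm_scale c p = word [] c * p"
    by (subst (1 2) p) (simp add: scale_sum_right sum_distrib_left word_mult)
  show "pm_scale c p = p * word [] c"
    by (subst (1 2) p) (simp add: scale_sum_right sum_distrib_right word_mult mult.commute)
qed

text \<open>Linear extension to \<^typ>\<open>'a \<Rightarrow>\<^sub>0 'f\<close> of a function on basis elements.\<close>

definition lin_ext :: "('f::field \<Rightarrow> 'v \<Rightarrow> 'v) \<Rightarrow> ('a \<Rightarrow> 'v::ab_group_add) \<Rightarrow> ('a \<Rightarrow>\<^sub>0 'f) \<Rightarrow> 'v" where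
  "lin_ext s g p = (\<Sum>a\<in>Poly_Mapping.keys p. s (Poly_Mapping.lookup p a) (g a))"

context vector_space
begin

lemma lin_ext_superset:
  assumes "finite A" "Poly_Mapping.keys p \<subseteq> A"
  shows "lin_ext scale g p = (\<Sum>a\<in>A. scale (Poly_Mapping.lookup p a) (g a))"
  unfolding lin_ext_def using assms
  by (intro sum.mono_neutral_left) (auto simp: in_keys_iff)

lemma lin_ext_zero [simp]: "lin_ext scale g 0 = 0"
  by (simp add: lin_ext_def)

lemma lin_ext_add: "lin_ext scale g (p + q) = lin_ext scale g p + lin_ext scale g q"
proof -
  let ?A = "Poly_Mapping.keys p \<union> Poly_Mapping.keys q"
  have "Poly_Mapping.keys (p + q) \<subseteq> ?A" by (rule keys_add)
  then show ?thesis
    by (simp add: lin_ext_superset[of ?A] lookup_add scale_left_distrib sum.distrib)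
qed

lemma lin_ext_scale: "lin_ext scale g (pm_scale c p) = scale c (lin_ext scale g p)"
proof -
  have "Poly_Mapping.keys (pm_scale c p) \<subseteq> Poly_Mapping.keys p" by (auto simp: in_keys_iff)
  then show ?thesis
    by (simp add: lin_ext_superset[of "Poly_Mapping.keys p"] scale_sum_right)
qed

lemma lin_ext_uminus: "lin_ext scale g (- p) = - lin_ext scale g p"
  using lin_ext_add[of g p "- p"] by (simp add: eq_neg_iff_add_eq_0 add.commute)

lemma lin_ext_diff: "lin_ext scale g (p - q) = lin_ext scale g p - lin_ext scale g q"
  using lin_ext_add[of g p "- q"] by (simp add: lin_ext_uminus)

lemma lin_ext_single [simp]: "lin_ext scale g (Poly_Mapping.single a c) = scale c (g a)"
  by (cases "c = 0") (simp_all add: lin_ext_def)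

lemma lin_ext_sum: "lin_ext scale g (sum f A) = (\<Sum>a\<in>A. lin_ext scale g (f a))"
  by (induction A rule: infinite_finite_induct) (simp_all add: lin_ext_add)

end

lemma pm_induct [case_names zero add word]:
  fixes p :: "'a \<Rightarrow>\<^sub>0 'f::field"
  assumes "P 0" "\<And>p q. P p \<Longrightarrow> P q \<Longrightarrow> P (p + q)" "\<And>w c. P (Poly_Mapping.single w c)"
  shows "P p"
proof -
  have "p = (\<Sum>w\<in>Poly_Mapping.keys p. Poly_Mapping.single w (Poly_Mapping.lookup p w))"
    by (rule poly_mapping_eqI)
       (auto simp: lookup_sum lookup_single when_def sum.delta in_keys_iff)
  moreover have "P (\<Sum>w\<in>A. Poly_Mapping.single w (Poly_Mapping.lookup p w))" for A
    by (induction A rule: infinite_finite_induct) (auto intro: assms)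
  ultimately show ?thesis by metis
qed

text \<open>The two-sided ideal generated by a subset of a ring with unit.\<close>

inductive_set ideal_hull :: "'a::ring_1 set \<Rightarrow> 'a set" for S where
  zero: "0 \<in> ideal_hull S"
| gen: "s \<in> S \<Longrightarrow> a * s * b \<in> ideal_hull S"
| add: "x \<in> ideal_hull S \<Longrightarrow> y \<in> ideal_hull S \<Longrightarrow> x + y \<in> ideal_hull S"

lemma ideal_hull_base: "s \<in> S \<Longrightarrow> s \<in> ideal_hull S"
  using ideal_hull.gen[of s S 1 1] by simp

lemma ideal_hull_left: "x \<in> ideal_hull S \<Longrightarrow> a * x \<in> ideal_hull S"
proof (induction rule: ideal_hull.induct)
  case (gen s c b)
  then show ?case using ideal_hull.gen[of s S "a * c" b] by (simp add: mult.assoc)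
qed (auto simp: distrib_left intro: ideal_hull.intros)

lemma ideal_hull_right: "x \<in> ideal_hull S \<Longrightarrow> x * a \<in> ideal_hull S"
proof (induction rule: ideal_hull.induct)
  case (gen s c b)
  then show ?case using ideal_hull.gen[of s S c "b * a"] by (simp add: mult.assoc)
qed (auto simp: distrib_right intro: ideal_hull.intros)

lemma ideal_hull_uminus: "x \<in> ideal_hull S \<Longrightarrow> - x \<in> ideal_hull S"
  using ideal_hull_left[of x S "- 1"] by simp

lemma ideal_hull_diff: "x \<in> ideal_hull S \<Longrightarrow> y \<in> ideal_hull S \<Longrightarrow> x - y \<in> ideal_hull S"
  using ideal_hull.add[of x S "- y"] ideal_hull_uminus[of y S] by simp

lemma ideal_hull_mult_cong:
  assumes "p - p' \<in> ideal_hull S" "q - q' \<in> ideal_hull S"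
  shows "p * q - p' * q' \<in> ideal_hull S"
proof -
  have "p * q - p' * q' = (p - p') * q + p' * (q - q')" by (simp add: algebra_simps)
  then show ?thesis
    using assms by (simp add: ideal_hull.add ideal_hull_left ideal_hull_right)
qed

lemma ideal_hull_add_cong:
  assumes "p - p' \<in> ideal_hull S" "q - q' \<in> ideal_hull S"
  shows "p + q - (p' + q') \<in> ideal_hull S"
  using ideal_hull.add[OF assms] by (simp add: algebra_simps)

lemma ideal_hull_uminus_cong:
  assumes "p - p' \<in> ideal_hull S"
  shows "- p - - p' \<in> ideal_hull S"
  using ideal_hull_uminus[OF assms] by (simp add: algebra_simps)

lemma ideal_hull_minus_cong:
  assumes "p - p' \<in> ideal_hull S" "q - q' \<in> ideal_hull S"
  shows "p - q - (p' - q') \<in> ideal_hull S"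
  using ideal_hull_diff[OF assms] by (simp add: algebra_simps)

lemma ideal_hull_scale_cong:
  fixes p :: "'a list \<Rightarrow>\<^sub>0 'f::field"
  assumes "p - p' \<in> ideal_hull S"
  shows "pm_scale c p - pm_scale c p' \<in> ideal_hull S"
  using ideal_hull_left[OF assms, of "word [] c"] by (simp add: pm_scale_eq_mult(1) algebra_simps)

lemma ideal_hull_trans:
  "p - q \<in> ideal_hull S \<Longrightarrow> q - r \<in> ideal_hull S \<Longrightarrow> p - r \<in> ideal_hull S"
  using ideal_hull.add[of "p - q" S "q - r"] by simp

lemma ideal_hull_sym: "p - q \<in> ideal_hull S \<Longrightarrow> q - p \<in> ideal_hull S"
  using ideal_hull_uminus[of "p - q" S] by simp

lemma equivp_ideal_hull: "equivp (\<lambda>p q. p - q \<in> ideal_hull S)"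
  by (rule equivpI)
     (auto simp: reflp_def symp_def transp_def ideal_hull.zero
           intro: ideal_hull_sym ideal_hull_trans)

subsection \<open>The Lie algebra of derivations of the matrix algebra\<close>

definition mat_scale :: "'f::field \<Rightarrow> 'f^'k^'k \<Rightarrow> 'f^'k^'k" where
  "mat_scale c = map_matrix ((*) c)"

lemma mat_scale_nth [simp]: "mat_scale c A $ i $ j = c * A $ i $ j"
  by (simp add: mat_scale_def)

interpretation mat: vector_space mat_scale
  by standard (simp_all add: vec_eq_iff algebra_simps)

lemma mat_scale_mult:
  fixes A B :: "'f::field^'k^'k"
  shows "mat_scale c A ** B = mat_scale c (A ** B)" "A ** mat_scale c B = mat_scale c (A ** B)"
  by (simp_all add: vec_eq_iff matrix_matrix_mult_def sum_distrib_left algebra_simps)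

lemma mat_mult_add:
  fixes A B C :: "'f::field^'k^'k"
  shows "(A + B) ** C = A ** C + B ** C" "A ** (B + C) = A ** B + A ** C"
  by (simp_all add: vec_eq_iff matrix_matrix_mult_def sum.distrib algebra_simps)

typedef (overloaded) ('f::field, 'k::finite) der =
  "{d :: 'f^'k^'k \<Rightarrow> 'f^'k^'k.
     (\<forall>A B. d (A + B) = d A + d B) \<and> (\<forall>c A. d (mat_scale c A) = mat_scale c (d A)) \<and>
     (\<forall>A B. d (A ** B) = d A ** B + A ** d B)}"
  morphisms app_der Abs_der
  by (rule exI[of _ "\<lambda>_. 0"]) (simp add: matrix_matrix_mult_def vec_eq_iff)

setup_lifting type_definition_der

lemma app_der_add [simp]: "app_der d (A + B) = app_der d A + app_der d B"
  and app_der_scale [simp]: "app_der d (mat_scale c A) = mat_scale c (app_der d A)"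
  and app_der_mult: "app_der d (A ** B) = app_der d A ** B + A ** app_der d B"
  using app_der[of d] by simp_all

lemma app_der_zero [simp]: "app_der d 0 = 0"
  using app_der_scale[of d 0 0] by (simp del: app_der_scale)

lemma app_der_diff: "app_der d (A - B) = app_der d A - app_der d B"
  using app_der_add[of d "A - B" B] by simp

lift_definition der_add :: "('f::field, 'k::finite) der \<Rightarrow> ('f, 'k) der \<Rightarrow> ('f, 'k) der"
  is "\<lambda>d e A. d A + e A"
  by (simp add: mat.scale_right_distrib mat_mult_add algebra_simps)

lift_definition der_scale :: "'f::field \<Rightarrow> ('f, 'k::finite) der \<Rightarrow> ('f, 'k) der"
  is "\<lambda>c d A. mat_scale c (d A)"
  by (simp add: mat.scale_right_distrib mat_scale_mult mult.commute)

lemma mat_mult_diff: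
  fixes A B C :: "'f::field^'k^'k"
  shows "(A - B) ** C = A ** C - B ** C" "A ** (B - C) = A ** B - A ** C"
  by (simp_all add: vec_eq_iff matrix_matrix_mult_def sum_subtractf algebra_simps)

lift_definition der_bracket :: "('f::field, 'k::finite) der \<Rightarrow> ('f, 'k) der \<Rightarrow> ('f, 'k) der"
  is "\<lambda>d e A. d (e A) - e (d A)"
  by (simp add: mat.scale_right_diff_distrib mat_mult_diff algebra_simps)

subsection \<open>The universal enveloping algebra and its action\<close>

text \<open>The tensor algebra of the vector space \<open>L\<close> of derivations is the free algebra on the
  set \<open>L\<close> modulo linearity; both this and the commutator relations are imposed at once.\<close>

definition uea_relators :: "(('f::field, 'k::finite) der list \<Rightarrow>\<^sub>0 'f) set" where
  "uea_relators =
     (\<Union>d e. {word [der_add d e] 1 - word [d] 1 - word [e] 1}) \<union>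
     (\<Union>c d. {word [der_scale c d] 1 - word [d] c}) \<union>
     (\<Union>d e. {word [d] 1 * word [e] 1 - word [e] 1 * word [d] 1 - word [der_bracket d e] 1})"

quotient_type (overloaded) ('f, 'k) uea = "('f::field, 'k::finite) der list \<Rightarrow>\<^sub>0 'f" /
  "\<lambda>p q. p - q \<in> ideal_hull uea_relators"
  by (rule equivp_ideal_hull)

text \<open>The extension of the action to the enveloping algebra: the product \<open>d\<^sub>1 \<cdots> d\<^sub>m\<close>
  acts as the composition \<open>d\<^sub>1 \<circ> \<cdots> \<circ> d\<^sub>m\<close>.\<close>

definition free_act :: "(('f::field, 'k::finite) der list \<Rightarrow>\<^sub>0 'f) \<Rightarrow> 'f^'k^'k \<Rightarrow> 'f^'k^'k" where
  "free_act p A = lin_ext mat_scale (\<lambda>ds. foldr app_der ds A) p"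

lemma foldr_app_der_add:
  "foldr app_der ds (A + B) = foldr app_der ds A + foldr app_der ds B"
  by (induction ds) simp_all

lemma foldr_app_der_scale:
  "foldr app_der ds (mat_scale c A) = mat_scale c (foldr app_der ds A)"
  by (induction ds) simp_all

lemma free_act_add [simp]: "free_act p (A + B) = free_act p A + free_act p B"
  by (simp add: free_act_def lin_ext_def foldr_app_der_add mat.scale_right_distrib sum.distrib)

lemma free_act_scale [simp]: "free_act p (mat_scale c A) = mat_scale c (free_act p A)"
  by (simp add: free_act_def lin_ext_def foldr_app_der_scale mat.scale_sum_right mult.commute)

lemma free_act_zero_right [simp]: "free_act p 0 = 0"
  using free_act_scale[of p 0 0] by (simp del: free_act_scale)

lemma free_act_word [simp]: "free_act (word ds c) A = mat_scale c (foldr app_der ds A)"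
  by (simp add: free_act_def mat.lin_ext_single)

lemma free_act_linear [simp]:
  "free_act 0 A = 0"
  "free_act (p + q) A = free_act p A + free_act q A"
  "free_act (p - q) A = free_act p A - free_act q A"
  "free_act (pm_scale c p) A = mat_scale c (free_act p A)"
  by (simp_all add: free_act_def mat.lin_ext_add mat.lin_ext_diff mat.lin_ext_scale)

lemma free_act_mult [simp]: "free_act (p * q) A = free_act p (free_act q A)"
proof (induction p rule: pm_induct)
  case (word v a)
  show ?case
    by (induction q rule: pm_induct)
       (simp_all add: distrib_left foldr_app_der_add foldr_app_der_scale word_mult
          mat.scale_right_distrib)
qed (simp_all add: distrib_right)

lemma free_act_relators: "s \<in> uea_relators \<Longrightarrow> free_act s A = 0"
  by (auto simp: uea_relators_def der_add.rep_eq der_scale.rep_eq der_bracket.rep_eq)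

lemma free_act_ideal: "p \<in> ideal_hull uea_relators \<Longrightarrow> free_act p A = 0"
  by (induction rule: ideal_hull.induct) (simp_all add: free_act_relators)

lift_definition uea_act :: "('f::field, 'k::finite) uea \<Rightarrow> 'f^'k^'k \<Rightarrow> 'f^'k^'k" is free_act
proof
  fix p q :: "('f, 'k) der list \<Rightarrow>\<^sub>0 'f" and A
  assume "p - q \<in> ideal_hull uea_relators"
  from free_act_ideal[OF this, of A] show "free_act p A = free_act q A" by simp
qed

instantiation uea :: (field, finite) ring_1
begin

lift_definition zero_uea :: "('a, 'b) uea" is 0 .
lift_definition one_uea :: "('a, 'b) uea" is 1 .
lift_definition plus_uea :: "('a, 'b) uea \<Rightarrow> ('a, 'b) uea \<Rightarrow> ('a, 'b) uea" is "(+)"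
  by (rule ideal_hull_add_cong)
lift_definition minus_uea :: "('a, 'b) uea \<Rightarrow> ('a, 'b) uea \<Rightarrow> ('a, 'b) uea" is "(-)"
  by (rule ideal_hull_minus_cong)
lift_definition uminus_uea :: "('a, 'b) uea \<Rightarrow> ('a, 'b) uea" is uminus
  by (rule ideal_hull_uminus_cong)
lift_definition times_uea :: "('a, 'b) uea \<Rightarrow> ('a, 'b) uea \<Rightarrow> ('a, 'b) uea" is "(*)"
  by (rule ideal_hull_mult_cong)

lemma uea_act_zero_one:
  "uea_act (0 :: ('a, 'b) uea) A = 0" "uea_act (1 :: ('a, 'b) uea) A = A"
proof -
  show "uea_act (0 :: ('a, 'b) uea) A = 0" by transfer simp
  have "(1 :: ('a, 'b) der list \<Rightarrow>\<^sub>0 'a) = word [] 1"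
    by (simp only: single_one[symmetric] zero_list_def)
  then have "free_act (1 :: ('a, 'b) der list \<Rightarrow>\<^sub>0 'a) A = free_act (word [] 1) A"
    by (rule arg_cong)
  then have "free_act (1 :: ('a, 'b) der list \<Rightarrow>\<^sub>0 'a) A = A" by simp
  then show "uea_act (1 :: ('a, 'b) uea) A = A" by transfer
qed

instance
proof
  have "(mat 1 :: 'a^'b^'b) \<noteq> 0" by (auto simp: vec_eq_iff mat_def)
  then show "(0 :: ('a, 'b) uea) \<noteq> 1"
    using uea_act_zero_one[of "mat 1"] by metis
qed (transfer; simp only: add.assoc mult.assoc add_0_left add.right_neutral mult_1_left mult_1_right
      left_minus distrib_left distrib_right diff_conv_add_uminus right_minus ideal_hull.zero,
    (simp add: add.commute ideal_hull.zero)?)+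

end

lift_definition uea_scale :: "'f::field \<Rightarrow> ('f, 'k::finite) uea \<Rightarrow> ('f, 'k) uea" is pm_scale
  by (rule ideal_hull_scale_cong)

definition uea_of :: "('f::field, 'k::finite) der \<Rightarrow> ('f, 'k) uea" where
  "uea_of d = abs_uea (word [d] 1)"

lemma uea_act_simps [simp]:
  "uea_act 0 A = 0"
  "uea_act 1 A = A"
  "uea_act (u + v) A = uea_act u A + uea_act v A"
  "uea_act (u * v) A = uea_act u (uea_act v A)"
  "uea_act (uea_scale c u) A = mat_scale c (uea_act u A)"
  "uea_act u (A + B) = uea_act u A + uea_act u B"
  "uea_act u (mat_scale c A) = mat_scale c (uea_act u A)"
  by (simp_all only: uea_act_zero_one) (transfer; simp; fail)+

lemma uea_act_of [simp]: "uea_act (uea_of d) A = app_der d A"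
  by (simp add: uea_of_def uea_act.abs_eq)

subsection \<open>The free algebra with an action, and differential identities\<close>

text \<open>The letter \<open>(i, u)\<close> stands for \<open>x\<^sub>i\<^sub>+\<^sub>1\<^sup>u\<close>. Elements without constant term
  form the free nonunital algebra on these letters.\<close>

definition fla_relators :: "((nat \<times> ('f::field, 'k::finite) uea) list \<Rightarrow>\<^sub>0 'f) set" where
  "fla_relators =
     (\<Union>i u v. {word [(i, u + v)] 1 - word [(i, u)] 1 - word [(i, v)] 1}) \<union>
     (\<Union>i c u. {word [(i, uea_scale c u)] 1 - word [(i, u)] c})"

quotient_type (overloaded) ('f, 'k) fla =
  "(nat \<times> ('f::field, 'k::finite) uea) list \<Rightarrow>\<^sub>0 'f" /
  partial: "\<lambda>p q. Poly_Mapping.lookup p [] = 0 \<and> Poly_Mapping.lookup q [] = 0 \<and>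
                  p - q \<in> ideal_hull fla_relators"
proof (rule part_equivpI)
  show "\<exists>p :: (nat \<times> ('f, 'k) uea) list \<Rightarrow>\<^sub>0 'f. Poly_Mapping.lookup p [] = 0 \<and>
          Poly_Mapping.lookup p [] = 0 \<and> p - p \<in> ideal_hull fla_relators"
    by (rule exI[of _ 0]) (simp add: ideal_hull.zero)
qed (unfold symp_def transp_def, blast intro: ideal_hull_sym, blast intro: ideal_hull_trans)

lemma lookup_mult_Nil:
  fixes p q :: "'a list \<Rightarrow>\<^sub>0 'f::field"
  shows "Poly_Mapping.lookup (p * q) [] = Poly_Mapping.lookup p [] * Poly_Mapping.lookup q []"
proof (induction p rule: pm_induct)
  case (word v a)
  show ?case
    by (induction q rule: pm_induct)
       (simp_all add: distrib_left lookup_add word_mult lookup_single when_def)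
qed (simp_all add: distrib_right lookup_add)

instantiation fla :: (field, finite) ring
begin

lift_definition zero_fla :: "('a, 'b) fla" is 0 by (simp add: ideal_hull.zero)
lift_definition plus_fla :: "('a, 'b) fla \<Rightarrow> ('a, 'b) fla \<Rightarrow> ('a, 'b) fla" is "(+)"
  by (simp add: lookup_add ideal_hull_add_cong)
lift_definition minus_fla :: "('a, 'b) fla \<Rightarrow> ('a, 'b) fla \<Rightarrow> ('a, 'b) fla" is "(-)"
  by (simp add: lookup_minus ideal_hull_minus_cong)
lift_definition uminus_fla :: "('a, 'b) fla \<Rightarrow> ('a, 'b) fla" is uminus
  by (auto intro: ideal_hull_sym)
lift_definition times_fla :: "('a, 'b) fla \<Rightarrow> ('a, 'b) fla \<Rightarrow> ('a, 'b) fla" is "(*)"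
  by (simp add: lookup_mult_Nil ideal_hull_mult_cong)

instance
  by standard
     (transfer; simp only: add.assoc mult.assoc add_0_left left_minus distrib_left distrib_right
        diff_conv_add_uminus right_minus ideal_hull.zero lookup_add lookup_uminus lookup_mult_Nil
        lookup_zero,
      (simp add: add.commute ideal_hull.zero)?)+

end

lift_definition fla_scale :: "'f::field \<Rightarrow> ('f, 'k::finite) fla \<Rightarrow> ('f, 'k) fla" is pm_scale
  by (simp add: ideal_hull_scale_cong)

interpretation fla: vector_space "fla_scale :: 'f::field \<Rightarrow> ('f, 'k::finite) fla \<Rightarrow> ('f, 'k) fla"
proof -
  interpret pm: vector_space "pm_scale :: 'f \<Rightarrow> ((nat \<times> ('f, 'k) uea) list \<Rightarrow>\<^sub>0 'f) \<Rightarrow> _"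
    by (rule vector_space_pm_scale)
  show "vector_space (fla_scale :: 'f \<Rightarrow> ('f, 'k) fla \<Rightarrow> ('f, 'k) fla)"
    by standard
       (transfer; simp add: pm.scale_right_distrib pm.scale_left_distrib lookup_add ideal_hull.zero)+
qed

definition fla_var :: "nat \<Rightarrow> ('f::field, 'k::finite) uea \<Rightarrow> ('f, 'k) fla" where
  "fla_var i u = abs_fla (word [(i, u)] 1)"

text \<open>Evaluation under the substitution \<open>x\<^sub>i\<^sup>u \<mapsto> (b\<^sub>i)\<^sup>u\<close>.\<close>

definition word_eval ::
    "(nat \<Rightarrow> 'f::field^'k^'k) \<Rightarrow> (nat \<times> ('f, 'k::finite) uea) list \<Rightarrow> 'f^'k^'k" where
  "word_eval b w = foldr (\<lambda>(i, u) A. uea_act u (b i) ** A) w (mat 1)"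

definition free_eval ::
    "(nat \<Rightarrow> 'f::field^'k^'k) \<Rightarrow> ((nat \<times> ('f, 'k::finite) uea) list \<Rightarrow>\<^sub>0 'f) \<Rightarrow> 'f^'k^'k" where
  "free_eval b = lin_ext mat_scale (word_eval b)"

lemma word_eval_append: "word_eval b (v @ w) = word_eval b v ** word_eval b w"
  by (induction v) (auto simp: word_eval_def matrix_mul_assoc)

lemma free_eval_linear [simp]:
  "free_eval b 0 = 0"
  "free_eval b (p + q) = free_eval b p + free_eval b q"
  "free_eval b (p - q) = free_eval b p - free_eval b q"
  "free_eval b (pm_scale c p) = mat_scale c (free_eval b p)"
  "free_eval b (word w c) = mat_scale c (word_eval b w)"
  by (simp_all add: free_eval_def mat.lin_ext_add mat.lin_ext_diff mat.lin_ext_scale)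

lemma mat_mult_zero [simp]:
  fixes A :: "'f::field^'k^'k"
  shows "0 ** A = 0" "A ** 0 = 0"
  by (simp_all add: vec_eq_iff matrix_matrix_mult_def)

lemma free_eval_mult [simp]: "free_eval b (p * q) = free_eval b p ** free_eval b q"
proof (induction p rule: pm_induct)
  case (word v a)
  show ?case
    by (induction q rule: pm_induct)
       (simp_all add: distrib_left word_mult mat_mult_add mat_scale_mult word_eval_append)
qed (simp_all add: distrib_right mat_mult_add)

lemma free_eval_relators: "s \<in> fla_relators \<Longrightarrow> free_eval b s = 0"
  by (auto simp: fla_relators_def word_eval_def mat_mult_add mat_scale_mult)

lemma free_eval_ideal: "p \<in> ideal_hull fla_relators \<Longrightarrow> free_eval b p = 0"
  by (induction rule: ideal_hull.induct) (simp_all add: free_eval_relators)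

lift_definition fla_eval ::
    "(nat \<Rightarrow> 'f::field^'k^'k) \<Rightarrow> ('f, 'k::finite) fla \<Rightarrow> 'f^'k^'k" is free_eval
proof -
  fix b :: "nat \<Rightarrow> 'f^'k^'k" and p q :: "(nat \<times> ('f, 'k) uea) list \<Rightarrow>\<^sub>0 'f"
  assume "Poly_Mapping.lookup p [] = 0 \<and> Poly_Mapping.lookup q [] = 0 \<and>
    p - q \<in> ideal_hull fla_relators"
  then show "free_eval b p = free_eval b q" using free_eval_ideal[of "p - q" b] by simp
qed

lemma fla_eval_simps [simp]:
  "fla_eval b 0 = 0"
  "fla_eval b (f + g) = fla_eval b f + fla_eval b g"
  "fla_eval b (fla_scale c f) = mat_scale c (fla_eval b f)"
  "fla_eval b (f * g) = fla_eval b f ** fla_eval b g"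
  by (transfer; simp)+

lemma fla_var_rel:
  "Poly_Mapping.lookup (word [(i, u)] 1) [] = 0 \<and> Poly_Mapping.lookup (word [(i, u)] 1) [] = 0 \<and>
   word [(i, u)] 1 - word [(i, u)] 1 \<in> ideal_hull fla_relators"
  by (simp add: lookup_single ideal_hull.zero)

lemma fla_eval_var [simp]: "fla_eval b (fla_var i u) = uea_act u (b i)"
  using fla_eval.abs_eq[OF fla_var_rel]
  by (simp add: fla_var_def word_eval_def)

lemma fla_var_add: "fla_var i (u + v) = fla_var i u + fla_var i v"
proof -
  have "word [(i, u + v)] 1 - word [(i, u)] 1 - word [(i, v)] 1 \<in> fla_relators"
    unfolding fla_relators_def by (rule UnI1) blast
  then have "word [(i, u + v)] 1 - (word [(i, u)] 1 + word [(i, v)] 1) \<in> ideal_hull fla_relators"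
    using ideal_hull_base by (simp only: diff_diff_eq)
  then have "abs_fla (word [(i, u + v)] 1) = abs_fla (word [(i, u)] 1 + word [(i, v)] 1)"
    by (intro Quotient3_rel_abs[OF Quotient3_fla]) (simp only: lookup_add lookup_single, simp)
  then show ?thesis
    by (simp only: fla_var_def plus_fla.abs_eq[OF fla_var_rel fla_var_rel])
qed

lemma fla_var_scale: "fla_var i (uea_scale c u) = fla_scale c (fla_var i u)"
proof -
  have "word [(i, uea_scale c u)] 1 - word [(i, u)] c \<in> fla_relators"
    unfolding fla_relators_def by (rule UnI2) blast
  then have "word [(i, uea_scale c u)] 1 - word [(i, u)] c \<in> ideal_hull fla_relators"
    by (rule ideal_hull_base)
  then have "abs_fla (word [(i, uea_scale c u)] 1) = abs_fla (word [(i, u)] c)"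
    by (intro Quotient3_rel_abs[OF Quotient3_fla]) (simp only: lookup_single, simp)
  then show ?thesis
    by (simp only: fla_var_def fla_scale.abs_eq[OF fla_var_rel] pm_scale_word mult_1_right)
qed

definition diff_Id :: "('f::field, 'k::finite) fla set" where
  "diff_Id = {f. \<forall>b. fla_eval b f = 0}"

text \<open>Products of nonempty lists, as the free algebra has no unit.\<close>

fun prod_list1 :: "'a::times list \<Rightarrow> 'a" where
  "prod_list1 [a] = a"
| "prod_list1 (a # b # as) = a * prod_list1 (b # as)"

definition diff_P :: "nat \<Rightarrow> ('f::field, 'k::finite) fla set" where
  "diff_P n = fla.span
     {prod_list1 (map (\<lambda>j. fla_var (\<sigma> j) (u j)) [0..<n]) | \<sigma> u. \<sigma> permutes {..<n}}"

lemma subspace_diff_Id: "fla.subspace diff_Id"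
  by (simp add: fla.subspace_def diff_Id_def)

text \<open>The value at \<open>0\<close> is a convention.\<close>

definition diff_codim :: "'f::field itself \<Rightarrow> 'k::finite itself \<Rightarrow> nat \<Rightarrow> nat" where
  "diff_codim F K n = (if n = 0 then 1 else
     vectorspace.dim field_ring
       (quotient_space fla_scale (diff_P n) (diff_P n \<inter> diff_Id :: ('f, 'k) fla set)))"

lemma vectorspace_diff_quotient:
  "vectorspace field_ring
     (quotient_space fla_scale (diff_P n) (diff_P n \<inter> diff_Id :: ('f::field, 'k::finite) fla set))"
  by (intro fla.vectorspace_quotient_space fla.subspace_inter subspace_diff_Id)
     (simp_all add: diff_P_def)

end

theory Submission
  imports Defs "HOL-Analysis.Determinants"
begin

text \<open>Write \<open>B\<close> for the algebra of \<open>k \<times> k\<close> matrices and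
  \<open>B = F 1 \<oplus> S\<close> with \<open>S\<close> the traceless matrices. The codimension
  \<open>c\<^sub>n\<close> is the dimension of the space of multilinear maps from
  \<open>B\<^sup>n\<close> to \<open>B\<close> that the multilinear differential polynomials of
  degree \<open>n\<close> induce. The proof determines this space completely.

  Derivations of \<open>B\<close> kill \<open>1\<close> and have traceless values
  (\<open>trace_app_der\<close>), so the operators coming from the enveloping algebra act on
  \<open>F 1\<close> by scalars and map \<open>S\<close> to itself (\<open>uea_act_one\<close>,
  \<open>trace_uea_act\<close>). Conversely every operator with these two properties comes from
  the enveloping algebra (\<open>ex_uea_act_coord_traceless\<close>,
  \<open>ex_uea_act_coord_unit\<close>). This is a density theorem, made explicit through
  \<open>(ad E\<^sub>i\<^sub>j)\<^sup>2 A = -2 A\<^sub>j\<^sub>i E\<^sub>i\<^sub>j\<close>, an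
  operator of rank one, and the simplicity of \<open>S\<close> as a Lie algebra
  (\<open>lie_ideal_traceless\<close>).

  Because the projections onto \<open>F 1\<close> and \<open>S\<close> are available in each
  variable, the induced maps can be studied separately for each choice of the set of arguments
  that are taken from \<open>S\<close>, the others being \<open>1\<close>. If this set is empty,
  the value is a scalar; if it has one element, the value lies in \<open>S\<close>; and if it has
  at least two, every multilinear map occurs, because \<open>S S\<close> spans \<open>B\<close>.
  In coordinates with respect to a basis consisting of \<open>1\<close> and traceless matrices,
  exactly \<open>(k\<^sup>2 - 1) + n (k\<^sup>2 - 1)\<close> of the \<open>k\<^sup>2
  (k\<^sup>2)\<^sup>n\<close> coefficients are forced to vanish
  (\<open>coord_unattained_eq_0\<close>, \<open>card_unattained\<close>), and the others are
  arbitrary (\<open>ex_diff_P_attained\<close>). Hence \<open>c\<^sub>n =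
  (k\<^sup>2)\<^sup>n\<^sup>+\<^sup>1 - (n + 1) (k\<^sup>2 - 1)\<close>
  (\<open>diff_codim_eq\<close>), a formula that also gives the conventional value
  \<open>1\<close> at \<open>n = 0\<close>. The growth rate and the generating function follow
  from it.\<close>

section \<open>Dimension of a quotient by dual families\<close>

text \<open>The functionals \<open>\<phi> t\<close> induce coordinates on the quotient, because
  \<open>W\<close> is their common kernel inside \<open>V\<close>; the elements \<open>f t\<close>
  dual to them therefore represent a basis of \<open>V/W\<close>.\<close>

lemma (in vector_space) dim_quotient_space_eq_card_dual:
  assumes V: "subspace V" and W: "subspace W" and WV: "W \<subseteq> V" and fin: "finite T"
    and add: "\<And>t x y. \<phi> t (x + y) = \<phi> t x + \<phi> t y"
    and scl: "\<And>t c x. \<phi> t (scale c x) = c * \<phi> t x"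
    and mem: "\<And>x. x \<in> V \<Longrightarrow> x \<in> W \<longleftrightarrow> (\<forall>t\<in>T. \<phi> t x = 0)"
    and fV: "\<And>t. t \<in> T \<Longrightarrow> f t \<in> V"
    and dual: "\<And>s t. s \<in> T \<Longrightarrow> t \<in> T \<Longrightarrow> \<phi> t (f s) = (if s = t then 1 else 0)"
  shows "vectorspace.dim field_ring (quotient_space scale V W) = card T"
proof -
  let ?Q = "quotient_space scale V W"
  interpret Q: vectorspace field_ring ?Q
    by (rule vectorspace_quotient_space[OF V W WV])
  have plus: "coset W u \<oplus>\<^bsub>?Q\<^esub> coset W v = coset W (u + v)" for u v
    by (simp add: quotient_space_def coset_add[OF W])
  have smult: "c \<odot>\<^bsub>?Q\<^esub> coset W u = coset W (scale c u)" for c u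
    by (simp add: quotient_space_def coset_scale[OF W])
  have zero: "\<zero>\<^bsub>?Q\<^esub> = coset W 0" by (simp add: quotient_space_def coset_zero)
  have carr: "coset W u \<in> carrier ?Q" if "u \<in> V" for u
    using that by (simp add: quotient_space_def)
  have zero\<phi>: "\<phi> t 0 = 0" for t using scl[of t 0 0] by simp
  have sum\<phi>: "\<phi> t (sum g S) = (\<Sum>s\<in>S. \<phi> t (g s))" for t g and S :: "'c set"
    by (induction S rule: infinite_finite_induct) (simp_all add: add zero\<phi>)
  have diff\<phi>: "\<phi> t (x - y) = \<phi> t x - \<phi> t y" for t x y
    using add[of t "x - y" y] by simp
  have expand: "\<phi> t (\<Sum>s\<in>T. scale (c s) (f s)) = c t" if "t \<in> T" for t c
  proof -
    have "\<phi> t (\<Sum>s\<in>T. scale (c s) (f s)) = (\<Sum>s\<in>T. if s = t then c t else 0)"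
      unfolding sum\<phi> by (rule sum.cong) (auto simp: scl dual that)
    also have "\<dots> = c t" using fin that by simp
    finally show ?thesis .
  qed
  have inV: "(\<Sum>s\<in>S. scale (c s) (f s)) \<in> V" if "S \<subseteq> T" for c S
    by (rule subspace_sum[OF V]) (use fV that in \<open>auto intro: subspace_scale[OF V]\<close>)
  define g where "g t = coset W (f t)" for t
  have inj: "inj_on g T"
  proof (rule inj_onI)
    fix s t assume st: "s \<in> T" "t \<in> T" "g s = g t"
    then have "f s - f t \<in> W" by (simp add: g_def coset_eq_iff[OF W])
    then have "\<phi> t (f s - f t) = 0"
      using mem[of "f s - f t"] WV st(2) by auto
    then show "s = t"
      using dual[OF st(1,2)] dual[OF st(2,2)] by (auto simp: diff\<phi> split: if_splits)
  qed
  have gQ: "g ` T \<subseteq> carrier ?Q" using fV carr by (auto simp: g_def)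
  have lc: "Q.lincomb a (g ` T) = coset W (\<Sum>t\<in>T. scale (a (g t)) (f t))" for a
  proof -
    have "S \<subseteq> T \<Longrightarrow> (\<Oplus>\<^bsub>?Q\<^esub>t\<in>S. a (g t) \<odot>\<^bsub>?Q\<^esub> g t) = coset W (\<Sum>t\<in>S. scale (a (g t)) (f t))" 
      if "finite S" for S
      using that
    proof (induction S rule: finite_induct)
      case empty
      then show ?case by (simp add: zero)
    next
      case (insert x S)
      have "(\<lambda>t. a (g t) \<odot>\<^bsub>?Q\<^esub> g t) \<in> S \<rightarrow> carrier ?Q" "a (g x) \<odot>\<^bsub>?Q\<^esub> g x \<in> carrier ?Q"
        using insert.prems fV by (auto simp: g_def smult intro!: carr subspace_scale[OF V])
      then show ?case
        using insert by (simp add: plus smult g_def)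
    qed
    moreover have "Q.lincomb a (g ` T) = (\<Oplus>\<^bsub>?Q\<^esub>t\<in>T. a (g t) \<odot>\<^bsub>?Q\<^esub> g t)"
      unfolding Q.lincomb_def
      by (rule Q.finsum_reindex[OF _ inj])
         (use fV in \<open>auto simp: g_def smult intro!: carr subspace_scale[OF V]\<close>)
    ultimately show ?thesis using fin by simp
  qed
  have "Q.lin_indpt (g ` T)"
  proof (rule Q.finite_lin_indpt2)
    fix a assume a: "a \<in> g ` T \<rightarrow> carrier field_ring" "Q.lincomb a (g ` T) = \<zero>\<^bsub>?Q\<^esub>"
    then have "(\<Sum>t\<in>T. scale (a (g t)) (f t)) \<in> W"
      by (simp add: lc zero coset_eq_iff[OF W])
    then have "\<forall>t\<in>T. a (g t) = 0"
      using mem[OF inV[OF subset_refl]] expand by simp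
    then show "\<forall>v\<in>g ` T. a v = \<zero>\<^bsub>field_ring\<^esub>" by (simp add: field_ring_def)
  qed (use fin gQ in auto)
  moreover have "Q.span (g ` T) = carrier ?Q"
  proof
    show "Q.span (g ` T) \<subseteq> carrier ?Q" by (rule Q.span_is_subset2[OF gQ])
    show "carrier ?Q \<subseteq> Q.span (g ` T)"
    proof
      fix C assume "C \<in> carrier ?Q"
      then obtain x where x: "x \<in> V" "C = coset W x" by (auto simp: quotient_space_def)
      define a where "a D = \<phi> (inv_into T g D) x" for D
      have ag: "a (g t) = \<phi> t x" if "t \<in> T" for t
        using that inj by (simp add: a_def)
      have "x - (\<Sum>t\<in>T. scale (\<phi> t x) (f t)) \<in> V"
        using x inV[of T] by (intro subspace_diff[OF V]) auto
      then have "x - (\<Sum>t\<in>T. scale (\<phi> t x) (f t)) \<in> W"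
        by (subst mem) (auto simp: diff\<phi> expand)
      then have "C = Q.lincomb a (g ` T)"
        unfolding lc x by (simp add: coset_eq_iff[OF W] ag cong: sum.cong)
      then show "C \<in> Q.span (g ` T)"
        unfolding Q.finite_span[OF finite_imageI[OF fin] gQ]
        by (auto simp: field_ring_def)
    qed
  qed
  ultimately have "Q.basis (g ` T)" using gQ by (simp add: Q.basis_def)
  then have "Q.dim = card (g ` T)" by (intro Q.dim_basis) (use fin in auto)
  then show ?thesis by (simp add: card_image[OF inj])
qed

section \<open>Matrix units and Lie ideals\<close>

definition unit_mat :: "'k \<Rightarrow> 'k \<Rightarrow> 'f::field^'k^'k" where
  "unit_mat i j = (\<chi> a b. if a = i \<and> b = j then 1 else 0)"

lemma unit_mat_nth [simp]: "unit_mat i j $ a $ b = (if a = i \<and> b = j then 1 else 0)"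
  by (simp add: unit_mat_def)

lemma mult_unit_mat_nth:
  fixes A :: "'f::field^'k::finite^'k"
  shows "(A ** unit_mat i j) $ a $ b = (if b = j then A $ a $ i else 0)"
    and "(unit_mat i j ** A) $ a $ b = (if a = i then A $ j $ b else 0)"
  by (simp_all add: matrix_matrix_mult_def if_distrib if_distribR sum.delta' cong: if_cong)

lemma unit_mat_mult:
  "unit_mat i j ** unit_mat k l = (if j = k then unit_mat i l else (0 :: 'f::field^'k::finite^'k))"
  by (simp add: vec_eq_iff mult_unit_mat_nth)

lemma trace_unit_mat [simp]:
  "trace (unit_mat i j :: 'f::field^'k::finite^'k) = (if i = j then 1 else 0)"
proof -
  have "(\<Sum>a\<in>UNIV. if a = i \<and> a = j then 1 else 0) = (\<Sum>a\<in>UNIV. if a = i then if i = j then 1 else 0 else (0 :: 'f))"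
    by (rule sum.cong) auto
  then show ?thesis by (simp add: trace_def)
qed

lemma trace_zero [simp]: "trace (0 :: 'f::field^'k::finite^'k) = 0"
  by (simp add: trace_def)

lemma trace_mat_scale [simp]: "trace (mat_scale c A) = c * trace (A :: 'f::field^'k::finite^'k)"
  by (simp add: trace_def sum_distrib_left)

lemma trace_sum: "trace (sum f S) = (\<Sum>x\<in>S. trace (f x :: 'f::field^'k::finite^'k))"
  by (induction S rule: infinite_finite_induct) (simp_all add: trace_add)

lemma trace_unit_mat_mult: "trace (unit_mat i j ** A) = (A :: 'f::field^'k::finite^'k) $ j $ i"
  by (simp add: trace_def mult_unit_mat_nth)

lemma mat_eq_sum_unit_mat:
  "(A :: 'f::field^'k::finite^'k) = (\<Sum>p\<in>UNIV. mat_scale (A $ fst p $ snd p) (unit_mat (fst p) (snd p)))"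
proof -
  have "(\<Sum>p\<in>UNIV. A $ fst p $ snd p * (if a = fst p \<and> b = snd p then 1 else 0)) =
      (\<Sum>p\<in>UNIV. if p = (a, b) then A $ a $ b else 0)" for a b
    by (rule sum.cong) auto
  then show ?thesis
    by (simp add: vec_eq_iff)
qed

text \<open>Subtracting \<open>E\<^sub>r\<^sub>r\<close> from every diagonal unit changes the
  usual expansion by \<open>trace A\<close> times \<open>E\<^sub>r\<^sub>r\<close>, and makes
  every summand traceless.\<close>

lemma traceless_eq_sum_unit_mat:
  fixes A :: "'f::field^'k::finite^'k"
  assumes "trace A = 0"
  shows "A = (\<Sum>p\<in>UNIV. mat_scale (A $ fst p $ snd p)
    (unit_mat (fst p) (snd p) - (if fst p = snd p then unit_mat r r else 0)))"
proof -
  let ?E = "unit_mat r r :: 'f^'k^'k"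
  have "(\<Sum>p\<in>UNIV. A $ fst p $ snd p * (if fst p = snd p then 1 else 0)) = trace A"
    unfolding UNIV_Times_UNIV[symmetric] sum.cartesian_product'
    by (simp add: trace_def if_distrib cong: if_cong)
  moreover have "(if fst p = snd p then ?E else 0) = mat_scale (if fst p = snd p then 1 else 0) ?E"
    for p :: "'k \<times> 'k" by simp
  ultimately have "(\<Sum>p\<in>UNIV. mat_scale (A $ fst p $ snd p) (if fst p = snd p then ?E else 0)) =
      mat_scale (trace A) ?E"
    by (simp only: mat.scale_scale mat.scale_sum_left[symmetric])
  then show ?thesis
    by (simp add: mat.scale_right_diff_distrib sum_subtractf assms mat_eq_sum_unit_mat[symmetric])
qed

text \<open>The traceless matrices form a simple Lie algebra, so any Lie ideal meeting them
  outside \<open>0\<close> contains all of them. An ideal that contains a single matrix unit off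
  the diagonal is all that is needed below, and then brackets with matrix units produce the others
  directly: a bracket with \<open>E\<^sub>c\<^sub>a\<close> changes the row of
  \<open>E\<^sub>a\<^sub>b\<close>, and a double bracket with \<open>E\<^sub>b\<^sub>a\<close>
  turns \<open>E\<^sub>a\<^sub>b\<close> into \<open>-2 E\<^sub>b\<^sub>a\<close>, which is where
  the characteristic enters.\<close>

lemma lie_ideal_traceless:
  fixes A :: "'f::field_char_0^'k::finite^'k"
  assumes S: "mat.subspace S" and lie: "\<And>X A. A \<in> S \<Longrightarrow> X ** A - A ** X \<in> S"
    and "i \<noteq> j" and base: "unit_mat i j \<in> S" and A: "trace A = 0"
  shows "A \<in> S"
proof -
  let ?E = "unit_mat :: 'k \<Rightarrow> 'k \<Rightarrow> 'f^'k^'k"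
  note um = unit_mat_mult mat_mult_diff
  have swap: "?E b a \<in> S" if "?E a b \<in> S" "a \<noteq> b" for a b
  proof -
    have "?E b a ** (?E b a ** ?E a b - ?E a b ** ?E b a) -
        (?E b a ** ?E a b - ?E a b ** ?E b a) ** ?E b a \<in> S"
      by (intro lie that)
    also have "?E b a ** (?E b a ** ?E a b - ?E a b ** ?E b a) -
        (?E b a ** ?E a b - ?E a b ** ?E b a) ** ?E b a = mat_scale (- 2) (?E b a)"
      using that(2) by (simp add: um vec_eq_iff)
    finally show ?thesis
      using mat.subspace_scale[OF S, of "mat_scale (- 2) (?E b a)" "- 1/2"] by simp
  qed
  have row: "?E c b \<in> S" if "?E a b \<in> S" "a \<noteq> b" "c \<noteq> b" for a b c
    using lie[OF that(1), of "?E c a"] that by (simp add: um)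
  have off: "?E k l \<in> S" if "k \<noteq> l" for k l
  proof (cases "k = j")
    case True
    with that show ?thesis
      using swap[OF row[OF base \<open>i \<noteq> j\<close>, of l]] by simp
  next
    case False
    have "?E j k \<in> S" by (rule swap[OF row[OF base \<open>i \<noteq> j\<close> False] False])
    then show ?thesis using swap[OF row, of j k l] False that by metis
  qed
  have diag: "?E a a - ?E b b \<in> S" for a b
  proof (cases "a = b")
    case False
    then show ?thesis using lie[OF off[of b a], of "?E a b"] by (simp add: um)
  qed (simp add: mat.subspace_0[OF S])
  \<comment> \<open>In this expansion the diagonal terms are brackets of matrix units off the diagonal.\<close>
  have "A = (\<Sum>p\<in>UNIV. mat_scale (A $ fst p $ snd p)
      (?E (fst p) (snd p) - (if fst p = snd p then ?E i i else 0)))"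
    by (rule traceless_eq_sum_unit_mat[OF A])
  moreover have "\<dots> \<in> S"
    by (intro mat.subspace_sum[OF S] mat.subspace_scale[OF S]) (auto simp: off diag)
  ultimately show ?thesis by simp
qed

section \<open>The action of the enveloping algebra on matrices\<close>

lift_definition inner_der :: "'f::field^'k^'k \<Rightarrow> ('f, 'k::finite) der" is "\<lambda>X A. X ** A - A ** X"
  by (simp add: mat_mult_add mat_mult_diff mat_scale_mult mat.scale_right_diff_distrib
      matrix_mul_assoc)

lemma uea_act_sum: "uea_act (sum f S) A = (\<Sum>x\<in>S. uea_act (f x) A)"
  by (induction S rule: infinite_finite_induct) simp_all

text \<open>The Jacobson density theorem for the traceless matrices, in an explicit form: every
  rank one operator \<open>A \<mapsto> trace (Y A) V\<close> with traceless \<open>Y\<close> and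
  \<open>V\<close> comes from the enveloping algebra. One such operator is visible, since
  \<open>(ad E\<^sub>i\<^sub>j)\<^sup>2 A = -2 A\<^sub>j\<^sub>i E\<^sub>i\<^sub>j\<close> for
  \<open>i \<noteq> j\<close>. Composition with an inner derivation on the left replaces
  \<open>V\<close> by a bracket with \<open>V\<close>, on the right it replaces \<open>Y\<close>
  by a bracket with \<open>Y\<close>; so the possible \<open>V\<close>, and then the possible
  \<open>Y\<close>, form a Lie ideal containing a matrix unit.\<close>

lemma ex_uea_act_trace_form:
  fixes Y V :: "'f::field_char_0^'k::finite^'k"
  assumes k: "2 \<le> CARD('k)" and Y: "trace Y = 0" and V: "trace V = 0"
  shows "\<exists>u. \<forall>A. uea_act u A = mat_scale (trace (Y ** A)) V"
proof -
  define R :: "('f^'k^'k) \<Rightarrow> ('f^'k^'k) \<Rightarrow> bool" where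
    "R Y V \<longleftrightarrow> (\<exists>u. \<forall>A. uea_act u A = mat_scale (trace (Y ** A)) V)" for Y V
  have RI: "R Y V" if "\<And>A. uea_act u A = mat_scale (trace (Y ** A)) V" for u Y V
    using that unfolding R_def by blast
  obtain i j :: 'k where ij: "i \<noteq> j"
    using k card_le_Suc0_iff_eq[of "UNIV :: 'k set"] by auto
  let ?E = "unit_mat i j :: 'f^'k^'k"
  have EAE: "?E ** A ** ?E = mat_scale (A $ j $ i) ?E" for A
    by (simp add: vec_eq_iff mult_unit_mat_nth)
  have EE: "?E ** ?E = 0" using ij by (simp add: unit_mat_mult)
  have base: "R ?E ?E"
  proof (rule RI)
    fix A
    let ?D = "uea_of (inner_der ?E)"
    have "uea_act (?D * ?D) A = ?E ** ?E ** A - ?E ** A ** ?E - (?E ** A ** ?E - A ** (?E ** ?E))"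
      by (simp add: inner_der.rep_eq mat_mult_diff matrix_mul_assoc)
    also have "\<dots> = mat_scale (- 2 * A $ j $ i) ?E"
      unfolding EE EAE by (simp add: vec_eq_iff)
    finally show "uea_act (uea_scale (- 1/2) (?D * ?D)) A = mat_scale (trace (?E ** A)) ?E"
      by (simp add: trace_unit_mat_mult)
  qed
  have "R ?E V"
  proof (rule lie_ideal_traceless[of "{V. R ?E V}" i j V, simplified mem_Collect_eq])
    show "mat.subspace {V. R ?E V}"
    proof (rule mat.subspaceI; simp only: mem_Collect_eq)
      show "R ?E 0" by (rule RI[of 0]) simp
      fix V W assume "R ?E V" "R ?E W"
      then obtain u w where "\<And>A. uea_act u A = mat_scale (trace (?E ** A)) V"
        "\<And>A. uea_act w A = mat_scale (trace (?E ** A)) W" unfolding R_def by blast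
      then show "R ?E (V + W)"
        by (intro RI[of "u + w"]) (simp add: mat.scale_right_distrib)
    next
      fix c V assume "R ?E V"
      then obtain u where "\<And>A. uea_act u A = mat_scale (trace (?E ** A)) V"
        unfolding R_def by blast
      then show "R ?E (mat_scale c V)"
        by (intro RI[of "uea_scale c u"]) (simp add: mult.commute)
    qed
    fix X V assume "R ?E V"
    then obtain u where "\<And>A. uea_act u A = mat_scale (trace (?E ** A)) V"
      unfolding R_def by blast
    then show "R ?E (X ** V - V ** X)"
      by (intro RI[of "uea_of (inner_der X) * u"])
         (simp add: inner_der.rep_eq mat_scale_mult mat.scale_right_diff_distrib)
  qed (use ij base V in auto)
  have "R Y V"
  proof (rule lie_ideal_traceless[of "{Y. R Y V}" i j Y, simplified mem_Collect_eq])
    show "mat.subspace {Y. R Y V}"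
    proof (rule mat.subspaceI; simp only: mem_Collect_eq)
      show "R 0 V" by (rule RI[of 0]) simp
      fix Y Z assume "R Y V" "R Z V"
      then obtain u w where "\<And>A. uea_act u A = mat_scale (trace (Y ** A)) V"
        "\<And>A. uea_act w A = mat_scale (trace (Z ** A)) V" unfolding R_def by blast
      then show "R (Y + Z) V"
        by (intro RI[of "u + w"]) (simp add: mat.scale_left_distrib mat_mult_add trace_add)
    next
      fix c Y assume "R Y V"
      then obtain u where "\<And>A. uea_act u A = mat_scale (trace (Y ** A)) V"
        unfolding R_def by blast
      then show "R (mat_scale c Y) V"
        by (intro RI[of "uea_scale c u"]) (simp add: mat_scale_mult)
    qed
    fix X Y assume "R Y V"
    then obtain u where u: "\<And>A. uea_act u A = mat_scale (trace (Y ** A)) V"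
      unfolding R_def by blast
    \<comment> \<open>The trace form is invariant, so the derivation moves from \<open>A\<close> to \<open>Y\<close> with a change of sign.\<close>
    have "trace (Y ** (X ** A - A ** X)) = - trace ((X ** Y - Y ** X) ** A)" for A
      using trace_mul_sym[of "Y ** A" X]
      by (simp add: mat_mult_diff matrix_mul_assoc trace_sub)
    then show "R (X ** Y - Y ** X) V"
      by (intro RI[of "uea_scale (- 1) (u * uea_of (inner_der X))"])
         (simp add: inner_der.rep_eq u)
  qed (use ij \<open>R ?E V\<close> Y in auto)
  then show ?thesis by (simp add: R_def)
qed

text \<open>If \<open>P\<^sup>2 = P\<close>, then \<open>d P = d P P + P d P\<close>.
  Multiplication by \<open>P\<close> on both sides gives \<open>P (d P) P = 0\<close>, so both
  summands have trace \<open>0\<close>. Every matrix is a combination of idempotents, because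
  \<open>E\<^sub>i\<^sub>i\<close> and \<open>E\<^sub>i\<^sub>i + E\<^sub>i\<^sub>j\<close> are
  idempotent.\<close>

lemma trace_app_der:
  fixes d :: "('f::field_char_0, 'k::finite) der"
  shows "trace (app_der d A) = 0"
proof -
  have idem: "trace (app_der d P) = 0" if P: "P ** P = P" for P
  proof -
    have d: "app_der d P = app_der d P ** P + P ** app_der d P"
      using app_der_mult[of d P P] P by simp
    have "P ** app_der d P ** P = P ** (app_der d P ** P + P ** app_der d P) ** P"
      using d by simp
    also have "\<dots> = P ** app_der d P ** P + P ** app_der d P ** P"
      by (simp add: mat_mult_add matrix_mul_assoc P) (metis P matrix_mul_assoc)
    finally have "P ** app_der d P ** P = 0" by simp
    then have "trace (P ** app_der d P) = 0"
      using trace_mul_sym[of P "P ** app_der d P"] P by (simp add: matrix_mul_assoc)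
    moreover from this have "trace (app_der d P ** P) = 0"
      by (subst trace_mul_sym)
    ultimately show ?thesis by (subst d) (simp add: trace_add)
  qed
  have unit: "trace (app_der d (unit_mat i j)) = 0" for i j
  proof (cases "i = j")
    case True
    then show ?thesis by (simp add: idem unit_mat_mult)
  next
    case False
    have "trace (app_der d (unit_mat i i + unit_mat i j)) = 0"
      by (rule idem) (use False in \<open>simp add: unit_mat_mult mat_mult_add\<close>)
    moreover have "trace (app_der d (unit_mat i i)) = 0"
      by (rule idem) (simp add: unit_mat_mult)
    ultimately show ?thesis by (simp add: trace_add)
  qed
  have sm: "app_der d (sum f S) = (\<Sum>x\<in>S. app_der d (f x))" for f and S :: "('k \<times> 'k) set"
    by (induction S rule: infinite_finite_induct) simp_all
  show ?thesis
    by (subst mat_eq_sum_unit_mat) (simp add: sm trace_sum unit)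
qed

lemma app_der_one: "app_der d (mat 1) = (0 :: 'f::field^'k::finite^'k)"
  using app_der_mult[of d "mat 1" "mat 1"] by simp

text \<open>Derivations annihilate the identity, so only the constant term of an element of the
  enveloping algebra contributes. Together with \<open>trace_uea_act\<close> this bounds what the
  enveloping algebra can do: its operators preserve the decomposition of the matrices into scalars
  and traceless matrices.\<close>

lemma uea_act_one: "\<exists>c. uea_act u (mat 1) = mat_scale c (mat 1 :: 'f::field^'k::finite^'k)"
proof (transfer fixing: )
  fix p :: "('f, 'k) der list \<Rightarrow>\<^sub>0 'f"
  have z: "foldr app_der ds 0 = (0 :: 'f^'k^'k)" for ds by (induction ds) simp_all
  have w: "ds \<noteq> [] \<Longrightarrow> foldr app_der ds (mat 1) = (0 :: 'f^'k^'k)" for ds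
    by (induction ds rule: rev_induct) (simp_all add: app_der_one z)
  show "\<exists>c. free_act p (mat 1) = mat_scale c (mat 1)"
  proof (induction p rule: pm_induct)
    case zero
    then show ?case by (intro exI[of _ 0]) simp
  next
    case (add p q)
    then show ?case by (auto simp: mat.scale_left_distrib[symmetric])
  next
    case (word ds c)
    then show ?case
      by (cases "ds = []") (auto simp: w intro: exI[of _ 0])
  qed
qed

lemma trace_uea_act:
  fixes A :: "'f::field_char_0^'k::finite^'k"
  assumes "trace A = 0"
  shows "trace (uea_act u A) = 0"
  using assms
proof (transfer fixing: A)
  fix p :: "('f, 'k) der list \<Rightarrow>\<^sub>0 'f"
  assume A: "trace A = 0"
  have "trace (foldr app_der ds A) = 0" for ds :: "('f, 'k) der list"
    by (cases ds) (simp_all add: A trace_app_der)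
  then show "trace (free_act p A) = 0"
    by (induction p rule: pm_induct) (simp_all add: trace_add)
qed

section \<open>A basis of the matrix algebra adapted to the action\<close>

text \<open>One basis vector is the identity and the others are traceless. The index \<open>(r,
  r)\<close>, at which the difference of diagonal units would vanish, is given to the identity;
  this keeps all pairs as the index set.\<close>

definition adapted_basis :: "'k \<Rightarrow> 'k \<times> 'k \<Rightarrow> 'f::field^'k^'k" where
  "adapted_basis r p =
     (if p = (r, r) then mat 1
      else if fst p = snd p then unit_mat (fst p) (fst p) - unit_mat r r
      else unit_mat (fst p) (snd p))"

definition adapted_coord :: "'k \<Rightarrow> 'f::field^'k^'k::finite \<Rightarrow> 'k \<times> 'k \<Rightarrow> 'f" where
  "adapted_coord r A p =
     (if p = (r, r) then trace A / of_nat CARD('k)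
      else A $ fst p $ snd p - (if fst p = snd p then trace A / of_nat CARD('k) else 0))"

lemma adapted_coord_add: "adapted_coord r (A + B) p = adapted_coord r A p + adapted_coord r B p"
  by (simp add: adapted_coord_def trace_add add_divide_distrib)

lemma adapted_coord_scale: "adapted_coord r (mat_scale c A) p = c * adapted_coord r A p"
  by (simp add: adapted_coord_def right_diff_distrib)

lemma trace_adapted_basis:
  "p \<noteq> (r, r) \<Longrightarrow> trace (adapted_basis r p :: 'f::field^'k::finite^'k) = 0"
  by (cases p) (auto simp: adapted_basis_def trace_sub)

lemma mat_nth_eq: "mat c $ i $ j = (if i = j then c else 0)"
  by (simp add: mat_def)

lemma adapted_coord_basis:
  "adapted_coord r (adapted_basis r p :: 'f::field_char_0^'k::finite^'k) q = (if p = q then 1 else 0)"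
proof (cases "p = (r, r)")
  case True
  then show ?thesis
    by (cases q) (auto simp: adapted_basis_def adapted_coord_def trace_I mat_nth_eq)
next
  case False
  from trace_adapted_basis[OF this] show ?thesis
    using False by (cases p; cases q) (auto simp: adapted_coord_def adapted_basis_def)
qed

lemma adapted_coord_one:
  "adapted_coord r (mat 1 :: 'f::field_char_0^'k::finite^'k) p = (if p = (r, r) then 1 else 0)"
  by (cases p) (auto simp: adapted_coord_def trace_I mat_nth_eq)

text \<open>For traceless matrices this is \<open>traceless_eq_sum_unit_mat\<close>; a general
  matrix is the sum of a traceless one and a scalar.\<close>

lemma sum_adapted_coord_basis:
  fixes A :: "'f::field_char_0^'k::finite^'k"
  shows "(\<Sum>p\<in>UNIV. mat_scale (adapted_coord r A p) (adapted_basis r p)) = A"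
proof -
  let ?S = "\<lambda>A. \<Sum>p\<in>UNIV. mat_scale (adapted_coord r A p) (adapted_basis r p :: 'f^'k^'k)"
  have add: "?S (A + B) = ?S A + ?S B" for A B
    by (simp add: adapted_coord_add mat.scale_left_distrib sum.distrib)
  define t where "t = mat_scale (trace A / of_nat CARD('k)) (mat 1 :: 'f^'k^'k)"
  have t: "?S t = t"
  proof -
    have "adapted_coord r t p = (if p = (r, r) then trace A / of_nat CARD('k) else 0)" for p
      by (simp add: t_def adapted_coord_scale adapted_coord_one)
    then have "?S t = (\<Sum>p\<in>UNIV. if p = (r, r) then t else 0)"
      by (intro sum.cong) (auto simp: t_def adapted_basis_def)
    then show ?thesis by simp
  qed
  have "trace (A - t) = 0" by (simp add: t_def trace_sub trace_I)
  then have "?S (A - t) = A - t"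
    by (subst (3) traceless_eq_sum_unit_mat[where r = r])
       (auto intro!: sum.cong simp: adapted_coord_def adapted_basis_def)
  then show ?thesis using add[of "A - t" t] t by simp
qed

lemma traceless_iff_adapted_coord:
  "adapted_coord r A (r, r) = 0 \<longleftrightarrow> trace (A :: 'f::field_char_0^'k::finite^'k) = 0"
  by (simp add: adapted_coord_def)

lemma adapted_coord_scalar:
  "p \<noteq> (r, r) \<Longrightarrow> adapted_coord r (mat_scale c (mat 1 :: 'f::field_char_0^'k::finite^'k)) p = 0"
  by (simp add: adapted_coord_scale adapted_coord_one)

text \<open>The coordinate \<open>p\<close> is the trace form with a traceless matrix
  \<open>Y\<close>: the transposed matrix unit, corrected on the diagonal by a multiple of the
  identity.\<close>

lemma ex_uea_act_coord_traceless:
  fixes V :: "'f::field_char_0^'k::finite^'k"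
  assumes k: "2 \<le> CARD('k)" and p: "p \<noteq> (r, r)" and V: "trace V = 0"
  shows "\<exists>u. \<forall>A. uea_act u A = mat_scale (adapted_coord r A p) V"
proof -
  define Y :: "'f^'k^'k" where
    "Y = unit_mat (snd p) (fst p) - mat_scale (if fst p = snd p then 1 / of_nat CARD('k) else 0) (mat 1)"
  have "trace Y = 0" by (auto simp: Y_def trace_sub trace_I)
  from ex_uea_act_trace_form[OF k this V] obtain u where
    "\<And>A. uea_act u A = mat_scale (trace (Y ** A)) V" by blast
  moreover have "trace (Y ** A) = adapted_coord r A p" for A
    using p by (simp add: Y_def mat_mult_diff mat_scale_mult trace_sub trace_unit_mat_mult adapted_coord_def)
  ultimately show ?thesis by auto
qed

text \<open>The projection onto the scalars is the identity minus the projections onto the other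
  basis vectors, each of which comes from the enveloping algebra.\<close>

lemma ex_uea_act_coord_unit:
  assumes k: "2 \<le> CARD('k::finite)"
  shows "\<exists>u. \<forall>A :: 'f::field_char_0^'k^'k. uea_act u A = mat_scale (adapted_coord r A (r, r)) (mat 1)"
proof -
  have "\<forall>p. \<exists>u. p \<noteq> (r, r) \<longrightarrow> (\<forall>A :: 'f^'k^'k. uea_act u A = mat_scale (adapted_coord r A p) (adapted_basis r p))"
    using ex_uea_act_coord_traceless[OF k _ trace_adapted_basis] by blast
  then obtain u where u: "\<And>p (A :: 'f^'k^'k). p \<noteq> (r, r) \<Longrightarrow>
      uea_act (u p) A = mat_scale (adapted_coord r A p) (adapted_basis r p)"
    by metis
  show ?thesis
  proof (intro exI allI)
    fix A :: "'f^'k^'k"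
    let ?P = "UNIV - {(r, r)}"
    have "A = mat_scale (adapted_coord r A (r, r)) (mat 1) + (\<Sum>p\<in>?P. uea_act (u p) A)"
      by (subst sum_adapted_coord_basis[of r A, symmetric], subst sum.remove[of _ "(r, r)"])
         (auto simp: u adapted_basis_def)
    then show "uea_act (1 + uea_scale (- 1) (\<Sum>p\<in>?P. u p)) A = mat_scale (adapted_coord r A (r, r)) (mat 1)"
      by (simp add: uea_act_sum algebra_simps)
  qed
qed

section \<open>Ordered products of matrices\<close>

text \<open>The componentwise product of vectors occupies the overloaded multiplication, so the
  matrix product needs its own iteration.\<close>

primrec mat_prod :: "(nat \<Rightarrow> 'f::field^'k^'k) \<Rightarrow> nat \<Rightarrow> 'f^'k^'k::finite" where
  "mat_prod a 0 = mat 1"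
| "mat_prod a (Suc n) = mat_prod a n ** a n"

lemma mat_prod_cong: "(\<And>m. m < n \<Longrightarrow> a m = b m) \<Longrightarrow> mat_prod a n = mat_prod b n"
  by (induction n) simp_all

lemma mat_prod_upd_last: "mat_prod (a(n := A)) (Suc n) = mat_prod a n ** A"
proof -
  have "mat_prod (a(n := A)) n = mat_prod a n" by (rule mat_prod_cong) simp
  then show ?thesis by simp
qed

lemma mat_prod_scale: "mat_prod (\<lambda>m. mat_scale (c m) (a m)) n = mat_scale (\<Prod>m<n. c m) (mat_prod a n)"
  by (induction n) (simp_all add: mat_scale_mult mult.commute)

lemma mat_prod_slot_add:
  "m < n \<Longrightarrow> mat_prod (a(m := A + B)) n = mat_prod (a(m := A)) n + mat_prod (a(m := B)) n"
proof (induction n)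
  case (Suc n)
  then show ?case
    by (cases "m = n") (simp_all only: mat_prod_upd_last mat_mult_add, simp_all add: mat_mult_add)
qed simp

lemma mat_prod_slot_scale:
  "m < n \<Longrightarrow> mat_prod (a(m := mat_scale c A)) n = mat_scale c (mat_prod (a(m := A)) n)"
proof (induction n)
  case (Suc n)
  then show ?case
    by (cases "m = n") (simp_all only: mat_prod_upd_last mat_scale_mult, simp_all add: mat_scale_mult)
qed simp

lemma mat_prod_scalars:
  assumes "\<And>m. m < n \<Longrightarrow> \<exists>c. a m = mat_scale c (mat 1 :: 'f::field^'k::finite^'k)"
  shows "\<exists>c. mat_prod a n = mat_scale c (mat 1)"
proof -
  from assms obtain c where "\<And>m. m < n \<Longrightarrow> a m = mat_scale (c m) (mat 1)" by metis
  then have "mat_prod a n = mat_prod (\<lambda>m. mat_scale (c m) (mat 1)) n" by (rule mat_prod_cong)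
  moreover have "mat_prod (\<lambda>m. mat 1 :: 'f^'k^'k) n = mat 1" by (induction n) simp_all
  ultimately show ?thesis by (auto simp: mat_prod_scale)
qed

text \<open>Scalars commute with everything, so such a product is a multiple of its only traceless
  factor.\<close>

lemma trace_mat_prod_one_slot:
  assumes "j < n" and tr: "trace (a j :: 'f::field^'k::finite^'k) = 0"
    and sc: "\<And>m. m < n \<Longrightarrow> m \<noteq> j \<Longrightarrow> \<exists>c. a m = mat_scale c (mat 1)"
  shows "trace (mat_prod a n) = 0"
  using assms(1) sc
proof (induction n)
  case (Suc n)
  show ?case
  proof (cases "j = n")
    case True
    then have "\<exists>c. mat_prod a n = mat_scale c (mat 1)"
      by (intro mat_prod_scalars) (simp add: Suc.prems)
    then show ?thesis using True tr by (auto simp: mat_scale_mult)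
  next
    case False
    then have "trace (mat_prod a n) = 0" using Suc by simp
    moreover have "\<exists>c. a n = mat_scale c (mat 1)" using Suc.prems(2)[of n] False by auto
    ultimately show ?thesis by (auto simp: mat_scale_mult)
  qed
qed simp

lemma ex_neq_of_two_le_card:
  assumes "2 \<le> CARD('k::finite)"
  shows "\<exists>j :: 'k. j \<noteq> i"
proof (rule ccontr)
  assume "\<not> ?thesis"
  then have "(UNIV :: 'k set) = {i}" by auto
  then have "CARD('k) = card {i}" by (rule arg_cong)
  with assms show False by simp
qed

text \<open>The matrix \<open>E\<^sub>i\<^sub>i - E\<^sub>j\<^sub>j\<close> acts as an identity on
  column \<open>i\<close> but is traceless: it makes it possible to lengthen a product by
  traceless factors without changing its value.\<close>

lemma ex_traceless_right_identity:
  fixes i :: "'k::finite"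
  assumes "2 \<le> CARD('k)"
  shows "\<exists>D :: 'f::field^'k^'k. trace D = 0 \<and> (\<forall>l. unit_mat l i ** D = unit_mat l i)"
proof -
  obtain j where "j \<noteq> i"
    using ex_neq_of_two_le_card[OF assms] by blast
  then show ?thesis
    by (intro exI[of _ "unit_mat i i - unit_mat j j"])
       (simp add: trace_sub mat_mult_diff unit_mat_mult)
qed

lemma unit_mat_eq_mult_traceless:
  fixes i j :: "'k::finite"
  assumes "2 \<le> CARD('k)"
  shows "\<exists>A B :: 'f::field^'k^'k. trace A = 0 \<and> trace B = 0 \<and> A ** B = unit_mat i j"
proof (cases "i = j")
  case True
  obtain l where "l \<noteq> i"
    using ex_neq_of_two_le_card[OF assms] by blast
  then show ?thesis using True
    by (intro exI[of _ "unit_mat i l"] exI[of _ "unit_mat l i"]) (simp add: unit_mat_mult)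
next
  case False
  obtain D :: "'f^'k^'k" where "trace D = 0" "\<And>l. unit_mat l j ** D = unit_mat l j"
    using ex_traceless_right_identity[OF assms, of j] by blast
  with False show ?thesis by (intro exI[of _ "unit_mat i j"] exI[of _ D]) simp
qed

text \<open>An operator from the enveloping algebra that vanishes at the identity has traceless
  values, which restricts the factors in the slots of \<open>S\<close>. The values of admissible
  products explain the shape of the codimension sequence: a product with no traceless slot is the
  identity, with one such slot it is an arbitrary traceless matrix, and with at least two of them
  every matrix unit occurs.\<close>

definition admissible :: "nat set \<Rightarrow> (nat \<Rightarrow> 'f::field^'k^'k::finite) \<Rightarrow> bool" where
  "admissible S a \<longleftrightarrow> (\<forall>m. if m \<in> S then trace (a m) = 0 else a m = mat 1)"

lemma admissible_upd:
  "admissible S a \<Longrightarrow> n \<in> S \<Longrightarrow> trace A = 0 \<Longrightarrow> admissible S (a(n := A))"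
  by (simp add: admissible_def)

lemma lessThan_Suc_Int: "{..<Suc n} \<inter> S = (if n \<in> S then insert n ({..<n} \<inter> S) else {..<n} \<inter> S)"
  by (auto simp: less_Suc_eq)

lemma mat_prod_admissible_none:
  assumes a: "admissible S a" and "card ({..<n} \<inter> S) = 0"
  shows "mat_prod a n = mat 1"
  using assms(2)
proof (induction n)
  case (Suc n)
  then have "n \<notin> S" by (auto simp: lessThan_Suc_Int split: if_splits)
  moreover from this have "a n = mat 1" using a by (simp add: admissible_def)
  ultimately show ?case using Suc by (simp add: lessThan_Suc_Int)
qed simp

lemma ex_admissible: "\<exists>a :: nat \<Rightarrow> 'f::field^'k::finite^'k. admissible S a"
  by (rule exI[of _ "\<lambda>m. if m \<in> S then 0 else mat 1"]) (simp add: admissible_def)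

lemma ex_mat_prod_eq_traceless:
  fixes A :: "'f::field^'k::finite^'k"
  assumes "card ({..<n} \<inter> S) = 1" and A: "trace A = 0"
  shows "\<exists>a. admissible S a \<and> mat_prod a n = A"
  using assms(1)
proof (induction n)
  case (Suc n)
  show ?case
  proof (cases "n \<in> S")
    case True
    obtain a :: "nat \<Rightarrow> 'f^'k^'k" where a: "admissible S a" using ex_admissible by blast
    have "card ({..<n} \<inter> S) = 0" using Suc.prems True by (simp add: lessThan_Suc_Int)
    then have "mat_prod a n = mat 1" by (rule mat_prod_admissible_none[OF a])
    then show ?thesis
      by (intro exI[of _ "a(n := A)"] conjI admissible_upd[OF a True A])
         (simp only: mat_prod_upd_last, simp)
  next
    case False
    then obtain a where "admissible S a" "mat_prod a n = A" 
      using Suc by (auto simp: lessThan_Suc_Int)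
    then show ?thesis using False by (intro exI[of _ a]) (simp add: admissible_def)
  qed
qed simp

text \<open>At the second traceless slot a matrix unit appears as a product of two traceless
  matrices; further slots are filled with factors that leave it unchanged.\<close>

lemma ex_mat_prod_eq_unit_mat:
  fixes i j :: "'k::finite"
  assumes k: "2 \<le> CARD('k)" and "2 \<le> card ({..<n} \<inter> S)"
  shows "\<exists>a. admissible S a \<and> mat_prod a n = (unit_mat i j :: 'f::field^'k^'k)"
  using assms(2)
proof (induction n)
  case (Suc n)
  show ?case
  proof (cases "n \<in> S")
    case False
    then obtain a where "admissible S a" "mat_prod a n = (unit_mat i j :: 'f::field^'k^'k)"
      using Suc by (auto simp: lessThan_Suc_Int)
    then show ?thesis using False by (intro exI[of _ a]) (simp add: admissible_def)
  next
    case True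
    have "\<exists>a A. admissible S a \<and> trace A = 0 \<and> mat_prod a n ** A = (unit_mat i j :: 'f^'k^'k)"
    proof (cases "2 \<le> card ({..<n} \<inter> S)")
      case True
      then show ?thesis
        using Suc.IH ex_traceless_right_identity[OF k, of j] by metis
    next
      case False
      then have "card ({..<n} \<inter> S) = 1" using Suc.prems \<open>n \<in> S\<close> by (simp add: lessThan_Suc_Int)
      then show ?thesis
        using unit_mat_eq_mult_traceless[OF k, of i j] ex_mat_prod_eq_traceless by metis
    qed
    then show ?thesis using admissible_upd[OF _ True] mat_prod_upd_last by metis
  qed
qed simp

section \<open>Multilinear differential polynomials as multilinear maps\<close>

definition multilin_monom :: "nat \<Rightarrow> (nat \<Rightarrow> nat) \<Rightarrow> (nat \<Rightarrow> ('f::field, 'k::finite) uea) \<Rightarrow> ('f, 'k) fla" where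
  "multilin_monom n \<sigma> u = prod_list1 (map (\<lambda>j. fla_var (\<sigma> j) (u j)) [0..<n])"

lemma prod_list1_snoc: "xs \<noteq> [] \<Longrightarrow> prod_list1 (xs @ [y]) = prod_list1 xs * (y :: 'a::semigroup_mult)"
  by (induction xs rule: prod_list1.induct) (simp_all add: mult.assoc)

lemma fla_eval_multilin_monom:
  assumes "0 < n"
  shows "fla_eval b (multilin_monom n \<sigma> u) = mat_prod (\<lambda>j. uea_act (u j) (b (\<sigma> j))) n"
  using assms
proof (induction n rule: nat_induct_non_zero)
  case (Suc n)
  then show ?case by (simp add: multilin_monom_def prod_list1_snoc)
qed (simp add: multilin_monom_def)

lemma diff_P_eq: "diff_P n = fla.span {multilin_monom n \<sigma> u | \<sigma> u. \<sigma> permutes {..<n}}"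
  by (simp add: diff_P_def multilin_monom_def)

lemma diff_P_induct [consumes 1, case_names zero add gen]:
  assumes "f \<in> diff_P n"
    and "P 0" "\<And>c f g. P f \<Longrightarrow> P g \<Longrightarrow> P (fla_scale c f + g)"
    and "\<And>\<sigma> u. \<sigma> permutes {..<n} \<Longrightarrow> P (multilin_monom n \<sigma> u)"
  shows "P f"
  using assms(1) unfolding diff_P_eq
  by (rule fla.span_induct_alt) (use assms(2-) in auto)

lemma fla_eval_cong:
  assumes "0 < n" "f \<in> diff_P n" and b: "\<And>m. m < n \<Longrightarrow> b m = b' m"
  shows "fla_eval b f = fla_eval b' f"
  using assms(2)
proof (induction f rule: diff_P_induct)
  case (gen \<sigma> u)
  have "b (\<sigma> j) = b' (\<sigma> j)" if "j < n" for j
    using permutes_in_image[OF gen, of j] that b by simp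
  then show ?case unfolding fla_eval_multilin_monom[OF assms(1)]
    by (intro mat_prod_cong) simp
qed simp_all

text \<open>A monomial contains the variable \<open>x\<^sub>m\<close> exactly once, in the slot
  that the permutation sends to \<open>m\<close>.\<close>

lemma fla_eval_slot_linear:
  assumes n: "0 < n" and f: "f \<in> diff_P n" and m: "m < n"
  shows "fla_eval (b(m := mat_scale c A + B)) f =
    mat_scale c (fla_eval (b(m := A)) f) + fla_eval (b(m := B)) f"
  using f
proof (induction f rule: diff_P_induct)
  case zero
  then show ?case by simp
next
  case (add d f g)
  then show ?case by (simp add: mat.scale_right_distrib mat.scale_left_commute algebra_simps)
next
  case (gen \<sigma> u)
  define j where "j = inv_into UNIV \<sigma> m"
  have j: "\<sigma> j = m" "j < n"
    using permutes_inverses(1)[OF gen, of m] permutes_in_image[OF permutes_inv[OF gen], of m] m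
    by (simp_all add: j_def)
  have "(\<lambda>i. uea_act (u i) ((b(m := C)) (\<sigma> i))) =
      (\<lambda>i. uea_act (u i) (b (\<sigma> i)))(j := uea_act (u j) C)" for C
    using j permutes_inj[OF gen] by (auto simp: fun_eq_iff inj_eq)
  then show ?case unfolding fla_eval_multilin_monom[OF n]
    by (simp add: mat_prod_slot_add[OF j(2)] mat_prod_slot_scale[OF j(2)])
qed

lemma fla_eval_slot_sum:
  assumes n: "0 < n" and f: "f \<in> diff_P n" and m: "m < n"
  shows "fla_eval (b(m := \<Sum>p\<in>T. mat_scale (c p) (e p))) f =
    (\<Sum>p\<in>T. mat_scale (c p) (fla_eval (b(m := e p)) f))"
proof (induction T rule: infinite_finite_induct)
  case (insert x F)
  then show ?case by (simp add: fla_eval_slot_linear[OF assms] del: fun_upd_apply)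
qed (use fla_eval_slot_linear[OF assms, of b "- 1" 0 0] in \<open>simp_all del: fun_upd_apply\<close>)

definition basis_subst :: "'k \<Rightarrow> (nat \<Rightarrow> 'k \<times> 'k) \<Rightarrow> nat \<Rightarrow> 'f::field^'k^'k" where
  "basis_subst r \<kappa> m = adapted_basis r (\<kappa> m)"

abbreviation tuples :: "nat \<Rightarrow> (nat \<Rightarrow> 'a) set" where
  "tuples n \<equiv> {..<n} \<rightarrow>\<^sub>E UNIV"

text \<open>By multilinearity it suffices to substitute basis vectors. The values of the variables
  are replaced by basis vectors one slot at a time.\<close>

lemma diff_Id_iff_basis_subst:
  fixes f :: "('f::field_char_0, 'k::finite) fla"
  assumes n: "0 < n" and f: "f \<in> diff_P n"
  shows "f \<in> diff_Id \<longleftrightarrow> (\<forall>\<kappa>\<in>tuples n. fla_eval (basis_subst r \<kappa>) f = 0)"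
proof
  assume "f \<in> diff_Id"
  then show "\<forall>\<kappa>\<in>tuples n. fla_eval (basis_subst r \<kappa>) f = 0" by (simp add: diff_Id_def)
next
  assume z: "\<forall>\<kappa>\<in>tuples n. fla_eval (basis_subst r \<kappa>) f = 0"
  have "fla_eval b f = 0" if "M \<le> n" "\<And>m. M \<le> m \<Longrightarrow> m < n \<Longrightarrow> b m \<in> range (adapted_basis r)" for M b
    using that
  proof (induction M arbitrary: b)
    case 0
    then have "\<forall>m<n. \<exists>p. b m = adapted_basis r p" by blast
    then obtain \<kappa> where \<kappa>: "\<And>m. m < n \<Longrightarrow> b m = adapted_basis r (\<kappa> m)" by metis
    have "fla_eval b f = fla_eval (basis_subst r (restrict \<kappa> {..<n})) f"
      by (rule fla_eval_cong[OF n f]) (simp add: basis_subst_def \<kappa>)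
    then show ?case using z by simp
  next
    case (Suc M)
    have M: "M < n" using Suc.prems(1) by simp
    have "fla_eval (b(M := adapted_basis r p)) f = 0" for p
      using Suc.prems M by (intro Suc.IH) (auto simp: le_eq_less_or_eq[of M] Suc_le_eq)
    then have "fla_eval (b(M := \<Sum>p\<in>UNIV. mat_scale (adapted_coord r (b M) p) (adapted_basis r p))) f = 0"
      unfolding fla_eval_slot_sum[OF n f M] by simp
    then show ?case by (simp add: sum_adapted_coord_basis)
  qed
  from this[of n] show "f \<in> diff_Id" by (simp add: diff_Id_def)
qed

section \<open>Counting the attained coefficients\<close>

text \<open>A multilinear map is given by one coefficient for each tuple \<open>\<kappa>\<close>
  of basis indices (one for each argument) and each basis index \<open>l\<close> of the value;
  \<open>z\<close> is the index of the identity. The pairs collected here are those at which the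
  coefficients of all multilinear differential polynomials vanish: if all arguments are the
  identity, the value is a scalar, and if all but one are, the value is traceless.\<close>

definition unattained :: "nat \<Rightarrow> 'i \<Rightarrow> ((nat \<Rightarrow> 'i) \<times> 'i) set" where
  "unattained n z = {(\<kappa>, l). \<kappa> \<in> tuples n \<and>
     (card ({..<n} \<inter> {m. \<kappa> m \<noteq> z}) = 0 \<and> l \<noteq> z \<or> card ({..<n} \<inter> {m. \<kappa> m \<noteq> z}) = 1 \<and> l = z)}"

text \<open>The constant tuple \<open>z\<close> contributes all \<open>l \<noteq> z\<close>, and
  each of the tuples that differ from it in one slot contributes \<open>l = z\<close>.\<close>

lemma card_unattained: "card (unattained n (z :: 'i::finite)) = (n + 1) * (CARD('i) - 1)"
proof -
  let ?U = "UNIV - {z}" and ?c = "\<lambda>m\<in>{..<n}. z"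
  let ?g = "\<lambda>(m, p). (?c(m := p), z)"
  have inj: "inj_on ?g ({..<n} \<times> ?U)"
  proof (rule inj_onI)
    fix x y assume "x \<in> {..<n} \<times> ?U" "y \<in> {..<n} \<times> ?U" "?g x = ?g y"
    then obtain m p m' p' where xy: "x = (m, p)" "y = (m', p')" "m < n" "p \<noteq> z"
      and eq: "?c(m := p) = ?c(m' := p')"
      by auto
    from fun_cong[OF eq, of m] have "p = (if m = m' then p' else z)" using xy by simp
    with xy show "x = y" by (simp split: if_splits)
  qed
  \<comment> \<open>In \<open>?g\<close> the pair \<open>(m, p)\<close> records the exceptional slot and the index it holds.\<close>
  have "unattained n z = {?c} \<times> ?U \<union> ?g ` ({..<n} \<times> ?U)"
  proof (intro equalityI subsetI)
    fix t assume "t \<in> unattained n z"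
    then obtain \<kappa> l where t: "t = (\<kappa>, l)" and \<kappa>: "\<kappa> \<in> tuples n" and
      c: "card ({..<n} \<inter> {m. \<kappa> m \<noteq> z}) = 0 \<and> l \<noteq> z \<or> card ({..<n} \<inter> {m. \<kappa> m \<noteq> z}) = 1 \<and> l = z"
      by (auto simp: unattained_def)
    from c show "t \<in> {?c} \<times> ?U \<union> ?g ` ({..<n} \<times> ?U)"
    proof (elim disjE conjE)
      assume "card ({..<n} \<inter> {m. \<kappa> m \<noteq> z}) = 0" "l \<noteq> z"
      then have "\<kappa> = ?c" using \<kappa> by (intro extensionalityI[of _ "{..<n}"]) (auto simp: PiE_def)
      then show ?thesis using t \<open>l \<noteq> z\<close> by simp
    next
      assume "card ({..<n} \<inter> {m. \<kappa> m \<noteq> z}) = 1" "l = z"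
      then obtain m where m: "{..<n} \<inter> {m. \<kappa> m \<noteq> z} = {m}"
        by (auto simp: card_1_singleton_iff)
      have "\<kappa> = ?c(m := \<kappa> m)"
        using \<kappa> m by (intro extensionalityI[of _ "{..<n}"]) (auto simp: PiE_def extensional_def)
      then show ?thesis using t \<open>l = z\<close> m by (intro UnI2 image_eqI[of _ _ "(m, \<kappa> m)"]) auto
    qed
  next
    fix t assume "t \<in> {?c} \<times> ?U \<union> ?g ` ({..<n} \<times> ?U)"
    then show "t \<in> unattained n z"
    proof
      assume "t \<in> {?c} \<times> ?U"
      then show ?thesis by (auto simp: unattained_def split: if_splits)
    next
      assume "t \<in> ?g ` ({..<n} \<times> ?U)"
      then obtain m p where t: "t = (?c(m := p), z)" "m < n" "p \<noteq> z" by auto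
      then have "{..<n} \<inter> {j. (?c(m := p)) j \<noteq> z} = {m}" by auto
      then show ?thesis using t by (auto simp: unattained_def PiE_def extensional_def)
    qed
  qed
  moreover have "({?c} \<times> ?U) \<inter> ?g ` ({..<n} \<times> ?U) = {}" by auto
  moreover have "card ?U = CARD('i) - 1" by (simp add: card_Diff_singleton)
  ultimately show ?thesis
    by (simp add: card_Un_disjoint card_image[OF inj] card_cartesian_product)
qed

lemma finite_tuples: "finite (tuples n :: (nat \<Rightarrow> 'i::finite) set)"
  by (rule finite_PiE) auto

lemma card_attained:
  fixes z :: "'i::finite"
  shows "card (tuples n \<times> UNIV - unattained n z) + (n + 1) * (CARD('i) - 1) = CARD('i) ^ (n + 1)"
proof -
  let ?T = "tuples n :: (nat \<Rightarrow> 'i) set"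
  have sub: "unattained n z \<subseteq> ?T \<times> UNIV" by (auto simp: unattained_def)
  have fin: "finite (?T \<times> (UNIV :: 'i set))" by (simp add: finite_tuples)
  have "card (?T \<times> (UNIV :: 'i set)) = CARD('i) ^ (n + 1)"
    by (simp add: card_cartesian_product card_PiE)
  then show ?thesis
    using card_Diff_subset[OF finite_subset[OF sub fin] sub] card_mono[OF fin sub]
    by (simp add: card_unattained)
qed

section \<open>The differential codimensions\<close>

lemma coord_unattained_eq_0:
  fixes f :: "('f::field_char_0, 'k::finite) fla"
  assumes n: "0 < n" and f: "f \<in> diff_P n" and l: "(\<kappa>, l) \<in> unattained n (r, r)"
  shows "adapted_coord r (fla_eval (basis_subst r \<kappa>) f) l = 0"
  using f
proof (induction f rule: diff_P_induct)
  case zero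
  then show ?case using adapted_coord_scale[of r 0 0 l] by simp
next
  case (add c f g)
  then show ?case by (simp add: adapted_coord_add adapted_coord_scale)
next
  case (gen \<sigma> u)
  let ?S = "{..<n} \<inter> {m. \<kappa> m \<noteq> (r, r)}"
  let ?a = "\<lambda>j. uea_act (u j) (basis_subst r \<kappa> (\<sigma> j)) :: 'f^'k^'k"
  have scalar: "\<exists>c. ?a j = mat_scale c (mat 1)" if "j < n" "\<sigma> j \<notin> ?S" for j
  proof -
    have "\<sigma> j < n" using that permutes_in_image[OF gen, of j] by simp
    then have "basis_subst r \<kappa> (\<sigma> j) = (mat 1 :: 'f^'k^'k)" using that by (simp add: basis_subst_def adapted_basis_def)
    then show ?thesis using uea_act_one[of "u j"] by simp
  qed
  consider "card ?S = 0" "l \<noteq> (r, r)" | "card ?S = 1" "l = (r, r)" using l by (auto simp: unattained_def)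
  then show ?case
  proof cases
    case 1
    then have "\<exists>c. mat_prod ?a n = mat_scale c (mat 1)" by (intro mat_prod_scalars scalar) auto
    then show ?thesis using 1 by (auto simp: fla_eval_multilin_monom[OF n] adapted_coord_scalar)
  next
    case 2
    then obtain m where m: "?S = {m}" by (auto simp: card_1_singleton_iff)
    then have "m \<in> \<sigma> ` {..<n}" using permutes_image[OF gen] by auto
    then obtain j where j: "j < n" "\<sigma> j = m" by auto
    have "trace (?a j) = 0"
      using m j by (auto simp: basis_subst_def intro!: trace_uea_act trace_adapted_basis)
    then have "trace (mat_prod ?a n) = 0"
    proof (rule trace_mat_prod_one_slot[where a = ?a, OF j(1)])
      fix i assume i: "i < n" "i \<noteq> j"
      then have "\<sigma> i \<noteq> m" using j injD[OF permutes_inj[OF gen], of i j] by auto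
      then have "\<sigma> i \<notin> ?S" unfolding m by simp
      with i(1) show "\<exists>c. ?a i = mat_scale c (mat 1)" by (rule scalar)
    qed
    then show ?thesis using 2 by (simp add: fla_eval_multilin_monom[OF n] traceless_iff_adapted_coord)
  qed
qed

text \<open>The remaining coefficients are independent. With the identity permutation, let
  \<open>u m\<close> act as the \<open>\<kappa> m\<close>-th coordinate functional times a chosen
  matrix \<open>a m\<close>: the product of these operators vanishes at all basis tuples other
  than \<open>\<kappa>\<close> and has value \<open>mat_prod a n\<close> there. The matrix
  \<open>a m\<close> must be traceless if \<open>\<kappa> m\<close> is not the index of the
  identity, and may be taken to be the identity otherwise, so the claim reduces to the values of
  admissible products. The values reached at \<open>\<kappa>\<close> form a subspace, so it is
  enough to reach matrix units.\<close>

lemma ex_diff_P_attained: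
  fixes r :: "'k::finite"
  assumes k: "2 \<le> CARD('k)" and n: "0 < n" and \<kappa>: "\<kappa> \<in> tuples n" and l: "(\<kappa>, l) \<notin> unattained n (r, r)"
  shows "\<exists>f :: ('f::field_char_0, 'k) fla. f \<in> diff_P n \<and> (\<forall>\<kappa>'\<in>tuples n. fla_eval (basis_subst r \<kappa>') f =
    (if \<kappa>' = \<kappa> then adapted_basis r l else 0))"
proof -
  define Q :: "('f^'k^'k) set" where "Q = {M. \<exists>f :: ('f, 'k) fla. f \<in> diff_P n \<and>
    (\<forall>\<kappa>'\<in>tuples n. fla_eval (basis_subst r \<kappa>') f = (if \<kappa>' = \<kappa> then M else 0))}"
  have sub: "fla.subspace (diff_P n :: ('f, 'k) fla set)" by (simp add: diff_P_def)
  have Q: "mat.subspace Q"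
  proof (rule mat.subspaceI)
    show "0 \<in> Q" unfolding Q_def mem_Collect_eq
      by (rule exI[of _ 0]) (simp add: fla.subspace_0[OF sub])
    fix M N assume "M \<in> Q" "N \<in> Q"
    then obtain f g where "f \<in> diff_P n" "g \<in> diff_P n"
      "\<forall>\<kappa>'\<in>tuples n. fla_eval (basis_subst r \<kappa>') f = (if \<kappa>' = \<kappa> then M else 0)"
      "\<forall>\<kappa>'\<in>tuples n. fla_eval (basis_subst r \<kappa>') g = (if \<kappa>' = \<kappa> then N else 0)"
      unfolding Q_def by blast
    then show "M + N \<in> Q" unfolding Q_def mem_Collect_eq
      by (intro exI[of _ "f + g"]) (simp add: fla.subspace_add[OF sub])
  next
    fix c M assume "M \<in> Q"
    then obtain f where "f \<in> diff_P n"
      "\<forall>\<kappa>'\<in>tuples n. fla_eval (basis_subst r \<kappa>') f = (if \<kappa>' = \<kappa> then M else 0)"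
      unfolding Q_def by blast
    then show "mat_scale c M \<in> Q" unfolding Q_def mem_Collect_eq
      by (intro exI[of _ "fla_scale c f"]) (simp add: fla.subspace_scale[OF sub])
  qed
  let ?S = "{m. \<kappa> m \<noteq> (r, r)}"
  have prod: "mat_prod a n \<in> Q" if a: "admissible ?S a" for a
  proof -
    have "\<exists>u. \<forall>A. uea_act u A = mat_scale (adapted_coord r A (\<kappa> m)) (a m)" for m
      using a ex_uea_act_coord_traceless[OF k, of "\<kappa> m" r "a m"] ex_uea_act_coord_unit[OF k, of r, where 'f = 'f]
      by (cases "\<kappa> m = (r, r)") (auto simp: admissible_def)
    then obtain u where u: "\<And>m A. uea_act (u m) A = mat_scale (adapted_coord r A (\<kappa> m)) (a m)"
      by metis
    have "fla_eval (basis_subst r \<kappa>') (multilin_monom n id u) = (if \<kappa>' = \<kappa> then mat_prod a n else 0)"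
      if \<kappa>': "\<kappa>' \<in> tuples n" for \<kappa>'
    proof -
      have "fla_eval (basis_subst r \<kappa>') (multilin_monom n id u) =
          mat_scale (\<Prod>m<n. if \<kappa>' m = \<kappa> m then 1 else 0) (mat_prod a n)"
        by (simp add: fla_eval_multilin_monom[OF n] u basis_subst_def adapted_coord_basis mat_prod_scale)
      also have "(\<Prod>m<n. if \<kappa>' m = \<kappa> m then 1 else 0) = (if \<kappa>' = \<kappa> then 1 else 0 :: 'f)"
      proof (cases "\<kappa>' = \<kappa>")
        case False
        then obtain m where "m < n" "\<kappa>' m \<noteq> \<kappa> m"
          using PiE_ext[OF \<kappa>' \<kappa>] by auto
        then show ?thesis using False by auto
      qed simp
      finally show ?thesis
        by (cases "\<kappa>' = \<kappa>") (simp_all only: if_True if_False mat.scale_one mat.scale_zero_left refl)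
    qed
    moreover have "multilin_monom n id u \<in> diff_P n"
      unfolding diff_P_eq by (rule fla.span_base) (use permutes_id in blast)
    ultimately show ?thesis unfolding Q_def by blast
  qed
  let ?s = "card ({..<n} \<inter> ?S)"
  have "adapted_basis r l \<in> Q"
  proof -
    consider "?s = 0" | "?s = 1" | "2 \<le> ?s" by linarith
    then show ?thesis
    proof cases
      case 1
      then have "l = (r, r)" using l \<kappa> by (auto simp: unattained_def)
      moreover obtain a :: "nat \<Rightarrow> 'f^'k^'k" where a: "admissible ?S a" using ex_admissible by blast
      ultimately show ?thesis
        using prod[OF a] mat_prod_admissible_none[OF a 1] by (simp add: adapted_basis_def)
    next
      case 2
      then have "l \<noteq> (r, r)" using l \<kappa> by (auto simp: unattained_def)
      then show ?thesis using ex_mat_prod_eq_traceless[OF 2 trace_adapted_basis, of l r] prod by metis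
    next
      case 3
      have "unit_mat i j \<in> Q" for i j
        using ex_mat_prod_eq_unit_mat[OF k 3, of i j] prod by metis
      then show ?thesis
        by (subst mat_eq_sum_unit_mat) (intro mat.subspace_sum[OF Q] mat.subspace_scale[OF Q])
    qed
  qed
  then show ?thesis by (simp add: Q_def)
qed

text \<open>The subtracted term is the number of unattained coefficients. The formula is stated as
  a sum because subtraction of natural numbers truncates.\<close>

theorem diff_codim_eq:
  fixes F :: "'f::field_char_0 itself" and K :: "'k::finite itself"
  assumes k: "2 \<le> CARD('k)"
  shows "diff_codim F K n + (n + 1) * (CARD('k)\<^sup>2 - 1) = (CARD('k)\<^sup>2) ^ (n + 1)"
proof (cases "n = 0")
  case True
  have "1 \<le> CARD('k)\<^sup>2" using k by simp
  then show ?thesis using True by (simp add: diff_codim_def)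
next
  case False
  then have n: "0 < n" by simp
  \<comment> \<open>Any index may serve as the reference index of the adapted basis.\<close>
  define r where "r = (undefined :: 'k)"
  let ?T = "tuples n \<times> UNIV - unattained n (r, r)"
  define \<phi> :: "(nat \<Rightarrow> 'k \<times> 'k) \<times> 'k \<times> 'k \<Rightarrow> ('f, 'k) fla \<Rightarrow> 'f" where
    "\<phi> t f = adapted_coord r (fla_eval (basis_subst r (fst t)) f) (snd t)" for t f
  define dual where "dual t f \<longleftrightarrow> f \<in> diff_P n \<and> (\<forall>\<kappa>\<in>tuples n.
      fla_eval (basis_subst r \<kappa>) f = (if \<kappa> = fst t then adapted_basis r (snd t) else 0))"
    for t and f :: "('f, 'k) fla"
  have "\<exists>f. dual t f" if t: "t \<in> ?T" for t
  proof -
    obtain \<kappa> l where eq: "t = (\<kappa>, l)" using surj_pair[of t] by blast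
    with t have "\<kappa> \<in> tuples n" "(\<kappa>, l) \<notin> unattained n (r, r)" by auto
    from ex_diff_P_attained[OF k n this] show ?thesis
      by (simp only: dual_def eq fst_conv snd_conv)
  qed
  then obtain f where f: "\<And>t. t \<in> ?T \<Longrightarrow> dual t (f t)" by metis
  have coord0: "adapted_coord r (0 :: 'f^'k^'k) p = 0" for p
    using adapted_coord_scale[of r 0 0 p] by simp
  have "vectorspace.dim field_ring (quotient_space fla_scale (diff_P n) (diff_P n \<inter> diff_Id :: ('f, 'k) fla set)) = card ?T"
  proof (rule fla.dim_quotient_space_eq_card_dual[where \<phi> = \<phi> and f = f])
    show "fla.subspace (diff_P n :: ('f, 'k) fla set)" by (simp add: diff_P_def)
    show "fla.subspace (diff_P n \<inter> diff_Id :: ('f, 'k) fla set)"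
      by (intro fla.subspace_inter subspace_diff_Id) (simp add: diff_P_def)
    show "finite ?T" by (simp add: finite_tuples)
    fix x :: "('f, 'k) fla" assume x: "x \<in> diff_P n"
    show "x \<in> diff_P n \<inter> diff_Id \<longleftrightarrow> (\<forall>t\<in>?T. \<phi> t x = 0)"
    proof
      assume "x \<in> diff_P n \<inter> diff_Id"
      then show "\<forall>t\<in>?T. \<phi> t x = 0" by (simp add: \<phi>_def diff_Id_def coord0)
    next
      assume z: "\<forall>t\<in>?T. \<phi> t x = 0"
      have "fla_eval (basis_subst r \<kappa>) x = 0" if "\<kappa> \<in> tuples n" for \<kappa>
      proof -
        have "adapted_coord r (fla_eval (basis_subst r \<kappa>) x) p = 0" for p
          using bspec[OF z, of "(\<kappa>, p)"] coord_unattained_eq_0[OF n x, of \<kappa> p r] that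
          by (cases "(\<kappa>, p) \<in> unattained n (r, r)") (auto simp: \<phi>_def)
        then show ?thesis
          by (subst sum_adapted_coord_basis[of r, symmetric]) simp
      qed
      with x show "x \<in> diff_P n \<inter> diff_Id"
        by (simp add: diff_Id_iff_basis_subst[OF n x, of r])
    qed
  next
    fix s t assume "s \<in> ?T" "t \<in> ?T"
    then show "\<phi> t (f s) = (if s = t then 1 else 0)"
      using f[of s] by (auto simp: dual_def \<phi>_def coord0 adapted_coord_basis prod_eq_iff)
  qed (use f in \<open>auto simp: dual_def \<phi>_def adapted_coord_add adapted_coord_scale\<close>)
  moreover have "CARD('k \<times> 'k) = CARD('k)\<^sup>2" by (simp add: power2_eq_square)
  ultimately show ?thesis
    using card_attained[of n "(r, r)"] n by (simp add: diff_codim_def)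
qed

section \<open>Growth and generating function of the codimensions\<close>

theorem corollary4p3p2:
  fixes F :: "'f::field_char_0 itself" and K :: "'k::finite itself" and k :: nat
  assumes "k = CARD('k)" and "k \<ge> 2"
  shows "((\<lambda>n. root n (real (diff_codim F K n))) \<longlonglongrightarrow> real (k ^ 2)) \<and>
    (Abs_fps (\<lambda>n. of_nat (diff_codim F K n)) :: rat fps) =
      fps_const (of_nat (k ^ 2)) / (1 - fps_const (of_nat (k ^ 2)) * fps_X)
      - fps_const (of_nat (k ^ 2) - 1) / (1 - fps_X) ^ 2"
proof (intro conjI)
  define q where "q = k\<^sup>2"
  have q: "2 \<le> q"
  proof -
    have "2 \<le> k * 1" using assms(2) by simp
    also have "\<dots> \<le> k * k" using assms(2) by (intro mult_le_mono2) simp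
    finally show ?thesis by (simp add: q_def power2_eq_square)
  qed
  have codim: "diff_codim F K n + (n + 1) * (q - 1) = q ^ (n + 1)" for n
    using diff_codim_eq[where F = F and K = K and n = n] assms unfolding q_def by simp
  show "(\<lambda>n. root n (real (diff_codim F K n))) \<longlonglongrightarrow> real (k ^ 2)"
    unfolding q_def[symmetric]
  proof (rule tendsto_sandwich)
    \<comment> \<open>The codimension lies between \<open>q ^ n\<close> and \<open>q ^ (n + 1)\<close>, and \<open>root n q\<close> tends to \<open>1\<close>.\<close>
    have root_q: "root n (real q ^ n) = real q" if "0 < n" for n
      using that by (simp add: real_root_power_cancel)
    show "\<forall>\<^sub>F n in sequentially. real q \<le> root n (real (diff_codim F K n))"
      using eventually_gt_at_top[of 0]
    proof eventually_elim
      case (elim n)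
      have "n + 1 \<le> q ^ n"
      proof (induction n)
        case (Suc n)
        have "Suc n + 1 \<le> 2 * (n + 1)" by simp
        also have "\<dots> \<le> q * q ^ n" using Suc q by (intro mult_mono) auto
        finally show ?case by simp
      qed simp
      then have "(n + 1) * (q - 1) \<le> q ^ n * (q - 1)" by (rule mult_right_mono) simp
      moreover have "q ^ n * (q - 1) + q ^ n = q ^ (n + 1)"
        using q by (cases q) (simp_all add: algebra_simps)
      ultimately have "q ^ n \<le> diff_codim F K n" using codim[of n] by linarith
      then have "real q ^ n \<le> real (diff_codim F K n)"
        by (metis of_nat_le_iff of_nat_power)
      then have "root n (real q ^ n) \<le> root n (real (diff_codim F K n))"
        using elim by (simp only: real_root_le_iff)
      then show ?case using root_q[OF elim] by simp
    qed
    show "\<forall>\<^sub>F n in sequentially. root n (real (diff_codim F K n)) \<le> root n (real q) * real q"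
      using eventually_gt_at_top[of 0]
    proof eventually_elim
      case (elim n)
      have "diff_codim F K n \<le> q * q ^ n" using codim[of n] by simp
      then have "real (diff_codim F K n) \<le> real q * real q ^ n"
        by (metis of_nat_le_iff of_nat_power of_nat_mult)
      then have "root n (real (diff_codim F K n)) \<le> root n (real q * real q ^ n)"
        using elim by (simp only: real_root_le_iff)
      then show ?case using root_q[OF elim] by (simp add: real_root_mult)
    qed
    show "(\<lambda>n. root n (real q) * real q) \<longlonglongrightarrow> real q"
      using tendsto_mult[OF LIMSEQ_root_const[of "real q"] tendsto_const[of "real q"]] q by simp
  qed simp
  let ?A = "Abs_fps (\<lambda>n. of_nat (diff_codim F K n)) :: rat fps"
  let ?B = "Abs_fps (\<lambda>n. of_nat q ^ (n + 1)) :: rat fps"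
  let ?C = "Abs_fps (\<lambda>n. of_nat (n + 1) * (of_nat q - 1)) :: rat fps"
  have "rat_of_nat (diff_codim F K n) = of_nat q ^ (n + 1) - of_nat (n + 1) * (of_nat q - 1)" for n
  proof -
    have "rat_of_nat (diff_codim F K n) + of_nat (n + 1) * of_nat (q - 1) = of_nat q ^ (n + 1)"
      by (metis codim of_nat_add of_nat_mult of_nat_power)
    moreover have "rat_of_nat (q - 1) = of_nat q - 1" using q by (simp add: of_nat_diff)
    ultimately show ?thesis by (simp only: eq_diff_eq)
  qed
  then have "?A = ?B - ?C" by (simp add: fps_eq_iff)
  also have "?B = fps_const (of_nat q) / (1 - fps_const (of_nat q) * fps_X)"
  proof -
    let ?D = "1 - fps_const (of_nat q) * fps_X :: rat fps"
    have prod: "?B * ?D = fps_const (of_nat q)"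
      by (rule fps_ext) (simp add: right_diff_distrib mult.assoc[symmetric] power_eq_if)
    have "fps_nth ?D 0 \<noteq> 0" by simp
    then have "?D \<noteq> 0" by (metis fps_zero_nth)
    from nonzero_mult_div_cancel_right[OF this, of ?B] show ?thesis
      unfolding prod by (rule sym)
  qed
  also have "?C = fps_const (of_nat q - 1) / (1 - fps_X) ^ 2"
  proof -
    let ?D = "(1 - fps_X) ^ 2 :: rat fps"
    have "?C * (1 - fps_X) = Abs_fps (\<lambda>n. of_nat q - 1)"
      by (rule fps_ext) (simp add: right_diff_distrib of_nat_diff algebra_simps)
    moreover have "Abs_fps (\<lambda>n. of_nat q - 1) * (1 - fps_X) = fps_const (of_nat q - 1 :: rat)"
      by (rule fps_ext) (simp add: right_diff_distrib)
    ultimately have prod: "?C * ?D = fps_const (of_nat q - 1)"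
      by (simp only: power2_eq_square mult.assoc[symmetric])
    have "fps_nth (1 - fps_X :: rat fps) 0 \<noteq> 0" by simp
    then have "(1 - fps_X :: rat fps) \<noteq> 0" by (metis fps_zero_nth)
    then have "?D \<noteq> 0" by simp
    from nonzero_mult_div_cancel_right[OF this, of ?C] show ?thesis
      unfolding prod by (rule sym)
  qed
  finally show "?A = fps_const (of_nat (k ^ 2)) / (1 - fps_const (of_nat (k ^ 2)) * fps_X)
      - fps_const (of_nat (k ^ 2) - 1) / (1 - fps_X) ^ 2"
    by (simp only: q_def)
qed

end
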